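(* Any $7$-dimensional almost abelian Lie algebra admitting a coKähler structure is isomorphic to one and only one of the following: - $\mathbb{R}^7$ (abelian); - $\mathbb{R}\xi\ltimes_{R(1)\oplus R(0)\oplus R(0)}\mathbb{R}^6$; - $\mathbb{R}\xi\ltimes_{R(1)\oplus R(\lambda)\oplus R(0)}\mathbb{R}^6$, $0<\lambda\leq1$; - $\mathbb{R}\xi\ltimes_{R(1)\oplus R(\lambda)\oplus R(\alpha)}\mathbb{R}^6$, $0<\alpha\leq\lambda\leq1$; - $\mathbb{R}\xi\times\mathfrak{h}_1$; - $\mathbb{R}\xi\times\mathfrak{h}_2$, with parameter $\lambda>0$; - $\mathbb{R}\xi\times\mathfrak{h}_3$, with parameters $0<\lambda_2\leq\lambda_1$. (Different values of the parameters give non-isomorphic Lie algebras.)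
   Context: All Lie algebras are real. A Lie algebra is almost abelian if it has an abelian ideal of codimension one. $\mathbb{R}x\ltimes_A\mathbb{R}^d$ denotes the Lie algebra with abelian ideal $\mathbb{R}^d$ and $\mathrm{ad}_x|_{\mathbb{R}^d}=A$. Notation: $R(\lambda)=\begin{pmatrix}0&-\lambda\\ \lambda&0\end{pmatrix}$, and $\oplus$ denotes the block-diagonal sum of matrices, with a scalar $c$ viewed as a $1\times1$ block. The six-dimensional Lie algebras are $\mathfrak{h}_1=\mathbb{R}h_0\ltimes_{1\oplus R(0)\oplus R(0)}\mathbb{R}^5$; $\mathfrak{h}_2=\mathbb{R}h_0\ltimes_{1\oplus R(\lambda)\oplus R(0)}\mathbb{R}^5$ with $\lambda>0$; $\mathfrak{h}_3=\mathbb{R}h_0\ltimes_{1\oplus R(\lambda_1)\oplus R(\lambda_2)}\mathbb{R}^5$ with $0<\lambda_2\leq\lambda_1$. $\mathbb{R}\xi\times\mathfrak{h}$ is the direct product with a one-dimensional Lie algebra. CoKähler structure on a Lie algebra $\mathfrak{g}$ of odd dimension: a quadruple $(J,\xi,\alpha,\langle\cdot,\cdot\rangle)$ with $J$ an endomorphism of $\mathfrak{g}$, $\xi\in\mathfrak{g}$ non-zero, $\alpha\in\mathfrak{g}^*$ and $\langle\cdot,\cdot\rangle$ an inner product such that $\alpha(\xi)=1$, $J^2=-\mathrm{Id}+\alpha\otimes\xi$, $\langle JX,JY\rangle=\langle X,Y\rangle-\alpha(X)\alpha(Y)$, $d\alpha=0$, $N_J=0$, $d\omega=0$, where $\omega(X,Y)=\langle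 JX,Y\rangle$, $d$ is the Chevalley–Eilenberg differential and $N_J(X,Y)=[JX,JY]-J[JX,Y]-J[X,JY]+J^2[X,Y]$. *)

theory Defs
  imports "HOL-Analysis.Analysis"
begin

text \<open>A real Lie algebra is a real vector space, given as a type of class
  \<^class>\<open>real_vector\<close>, together with a bracket on it.\<close>

locale lie_algebra =
  fixes br :: "'a::real_vector \<Rightarrow> 'a \<Rightarrow> 'a"
  assumes bilinear_br: "bilinear br"
    and alternating: "br x x = 0"
    and jacobi: "br x (br y z) + br y (br z x) + br z (br x y) = 0"

definition lie_iso ::
    "('a::real_vector \<Rightarrow> 'a \<Rightarrow> 'a) \<Rightarrow> ('b::real_vector \<Rightarrow> 'b \<Rightarrow> 'b) \<Rightarrow> bool" where
  "lie_iso br br' \<longleftrightarrow>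
     (\<exists>f. linear f \<and> bij f \<and> (\<forall>x y. f (br x y) = br' (f x) (f y)))"

definition lie_ideal :: "('a::real_vector \<Rightarrow> 'a \<Rightarrow> 'a) \<Rightarrow> 'a set \<Rightarrow> bool" where
  "lie_ideal br I \<longleftrightarrow> subspace I \<and> (\<forall>x. \<forall>y\<in>I. br x y \<in> I)"

text \<open>Meant for finite-dimensional spaces; \<^const>\<open>dim\<close> is 0 on infinite-dimensional ones.\<close>

definition almost_abelian :: "('a::real_vector \<Rightarrow> 'a \<Rightarrow> 'a) \<Rightarrow> bool" where
  "almost_abelian br \<longleftrightarrow>
     (\<exists>I. lie_ideal br I \<and> (\<forall>x\<in>I. \<forall>y\<in>I. br x y = 0) \<and> dim I + 1 = dim (UNIV :: 'a set))"

definition inner_product :: "('a::real_vector \<Rightarrow> 'a \<Rightarrow> real) \<Rightarrow> bool" where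
  "inner_product g \<longleftrightarrow>
     bilinear g \<and> (\<forall>x y. g x y = g y x) \<and> (\<forall>x. x \<noteq> 0 \<longrightarrow> g x x > 0)"

text \<open>The Chevalley--Eilenberg differential (trivial coefficients) on 1-forms and on 2-forms.\<close>

definition ce_d1 ::
    "('a::real_vector \<Rightarrow> 'a \<Rightarrow> 'a) \<Rightarrow> ('a \<Rightarrow> real) \<Rightarrow> 'a \<Rightarrow> 'a \<Rightarrow> real" where
  "ce_d1 br \<alpha> x y = - \<alpha> (br x y)"

definition ce_d2 ::
    "('a::real_vector \<Rightarrow> 'a \<Rightarrow> 'a) \<Rightarrow> ('a \<Rightarrow> 'a \<Rightarrow> real) \<Rightarrow> 'a \<Rightarrow> 'a \<Rightarrow> 'a \<Rightarrow> real" where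
  "ce_d2 br \<omega> x y z = - \<omega> (br x y) z + \<omega> (br x z) y - \<omega> (br y z) x"

definition nijenhuis ::
    "('a::real_vector \<Rightarrow> 'a \<Rightarrow> 'a) \<Rightarrow> ('a \<Rightarrow> 'a) \<Rightarrow> 'a \<Rightarrow> 'a \<Rightarrow> 'a" where
  "nijenhuis br J x y = br (J x) (J y) - J (br (J x) y) - J (br x (J y)) + J (J (br x y))"

locale cokahler_structure = lie_algebra br
  for br :: "'a::real_vector \<Rightarrow> 'a \<Rightarrow> 'a" +
  fixes J :: "'a \<Rightarrow> 'a" and \<xi> :: 'a and \<alpha> :: "'a \<Rightarrow> real" and g :: "'a \<Rightarrow> 'a \<Rightarrow> real"
  assumes odd_dim: "odd (dim (UNIV :: 'a set))"
    and linear_J: "linear J"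
    and xi_nonzero: "\<xi> \<noteq> 0"
    and linear_alpha: "linear \<alpha>"
    and inner_product_g: "inner_product g"
    and alpha_xi: "\<alpha> \<xi> = 1"
    and J_squared: "J (J x) = - x + \<alpha> x *\<^sub>R \<xi>"
    and J_compatible: "g (J x) (J y) = g x y - \<alpha> x * \<alpha> y"
    and d_alpha: "ce_d1 br \<alpha> x y = 0"
    and N_J: "nijenhuis br J x y = 0"
    and d_omega: "ce_d2 br (\<lambda>u v. g (J u) v) x y z = 0"

definition abelian_bracket :: "'a::real_vector \<Rightarrow> 'a \<Rightarrow> 'a" where
  "abelian_bracket x y = 0"

text \<open>The bracket of \<open>\<real>x \<ltimes>\<^sub>A \<real>\<^sup>d\<close>: the pair \<open>(s, u)\<close> stands for \<open>s x + u\<close>.\<close>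

definition semidirect :: "real^'d^'d \<Rightarrow> real \<times> (real^'d) \<Rightarrow> real \<times> (real^'d) \<Rightarrow> real \<times> (real^'d)" where
  "semidirect A p q = (0, fst p *\<^sub>R (A *v snd q) - fst q *\<^sub>R (A *v snd p))"

definition direct_product ::
    "('a::real_vector \<Rightarrow> 'a \<Rightarrow> 'a) \<Rightarrow> ('b::real_vector \<Rightarrow> 'b \<Rightarrow> 'b) \<Rightarrow> 'a \<times> 'b \<Rightarrow> 'a \<times> 'b \<Rightarrow> 'a \<times> 'b" where
  "direct_product br br' p q = (br (fst p) (fst q), br' (snd p) (snd q))"

text \<open>Block-diagonal sum. The rows and columns of the sum are indexed by the disjoint union of the
  two index types, so \<open>\<real>\<^sup>6\<close> and \<open>\<real>\<^sup>5\<close> occur below as \<^typ>\<open>real^(2+2+2)\<close> and \<^typ>\<open>real^(1+2+2)\<close>.\<close>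

definition block_sum :: "real^'m^'m \<Rightarrow> real^'n^'n \<Rightarrow> real^('m+'n)^('m+'n)"  (infixr "\<oplus>\<^sub>m" 65) where
  "A \<oplus>\<^sub>m B = (\<chi> i j. case i of
       Inl a \<Rightarrow> (case j of Inl b \<Rightarrow> A $ a $ b | Inr _ \<Rightarrow> 0)
     | Inr a \<Rightarrow> (case j of Inl _ \<Rightarrow> 0 | Inr b \<Rightarrow> B $ a $ b))"

definition Rmat :: "real \<Rightarrow> real^2^2" where
  "Rmat l = vector [vector [0, - l], vector [l, 0]]"

abbreviation scalar_block :: "real \<Rightarrow> real^1^1" where
  "scalar_block c \<equiv> mat c"

type_synonym R6 = "real^(2+2+2)"
type_synonym R5 = "real^(1+2+2)"

definition rot :: "real \<Rightarrow> real \<Rightarrow> real \<Rightarrow> real \<times> R6 \<Rightarrow> real \<times> R6 \<Rightarrow> real \<times> R6" where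
  "rot a b c = semidirect (Rmat a \<oplus>\<^sub>m Rmat b \<oplus>\<^sub>m Rmat c)"

definition h1 :: "real \<times> R5 \<Rightarrow> real \<times> R5 \<Rightarrow> real \<times> R5" where
  "h1 = semidirect (scalar_block 1 \<oplus>\<^sub>m Rmat 0 \<oplus>\<^sub>m Rmat 0)"

definition h2 :: "real \<Rightarrow> real \<times> R5 \<Rightarrow> real \<times> R5 \<Rightarrow> real \<times> R5" where
  "h2 l = semidirect (scalar_block 1 \<oplus>\<^sub>m Rmat l \<oplus>\<^sub>m Rmat 0)"

definition h3 :: "real \<Rightarrow> real \<Rightarrow> real \<times> R5 \<Rightarrow> real \<times> R5 \<Rightarrow> real \<times> R5" where
  "h3 l1 l2 = semidirect (scalar_block 1 \<oplus>\<^sub>m Rmat l1 \<oplus>\<^sub>m Rmat l2)"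

definition R_times ::
    "('a::real_vector \<Rightarrow> 'a \<Rightarrow> 'a) \<Rightarrow> real \<times> 'a \<Rightarrow> real \<times> 'a \<Rightarrow> real \<times> 'a" where
  "R_times br = direct_product abelian_bracket br"

text \<open>Names for the entries of the classification, parameters included. The algebras they denote
  live on different types, so \<open>iso_to\<close> says directly that a bracket is isomorphic to an entry.\<close>

datatype entry =
    Abelian
  | Rot1
  | Rot2 real
  | Rot3 real real
  | Prod1
  | Prod2 real
  | Prod3 real real

fun admissible :: "entry \<Rightarrow> bool" where
  "admissible Abelian \<longleftrightarrow> True"
| "admissible Rot1 \<longleftrightarrow> True"
| "admissible (Rot2 l) \<longleftrightarrow> 0 < l \<and> l \<le> 1"
| "admissible (Rot3 l a) \<longleftrightarrow> 0 < a \<and> a \<le> l \<and> l \<le> 1"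
| "admissible Prod1 \<longleftrightarrow> True"
| "admissible (Prod2 l) \<longleftrightarrow> 0 < l"
| "admissible (Prod3 l1 l2) \<longleftrightarrow> 0 < l2 \<and> l2 \<le> l1"

fun iso_to :: "('a::real_vector \<Rightarrow> 'a \<Rightarrow> 'a) \<Rightarrow> entry \<Rightarrow> bool" where
  "iso_to br Abelian \<longleftrightarrow> lie_iso br (abelian_bracket :: real^7 \<Rightarrow> real^7 \<Rightarrow> real^7)"
| "iso_to br Rot1 \<longleftrightarrow> lie_iso br (rot 1 0 0)"
| "iso_to br (Rot2 l) \<longleftrightarrow> lie_iso br (rot 1 l 0)"
| "iso_to br (Rot3 l a) \<longleftrightarrow> lie_iso br (rot 1 l a)"
| "iso_to br Prod1 \<longleftrightarrow> lie_iso br (R_times h1)"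
| "iso_to br (Prod2 l) \<longleftrightarrow> lie_iso br (R_times (h2 l))"
| "iso_to br (Prod3 l1 l2) \<longleftrightarrow> lie_iso br (R_times (h3 l1 l2))"

end

theory Submission imports Defs begin

text \<open>The endomorphism \<open>J\<close> makes \<open>ker \<alpha>\<close> a Hermitian space, and \<open>N\<^sub>J = 0\<close>, \<open>d\<omega> = 0\<close> say that \<open>ad x\<close> is
  skew-Hermitian on any \<open>J\<close>-invariant abelian subspace of \<open>ker \<alpha>\<close> that it preserves and that
  commutes with \<open>J x\<close>; such an operator is an orthogonal sum of blocks \<open>R(m)\<close>. Let \<open>I\<close> be an abelian
  ideal of codimension one. If \<open>I = ker \<alpha>\<close>, this applies to \<open>x = \<xi>\<close> and gives the algebras
  \<open>\<real>\<xi> \<ltimes> \<real>\<^sup>6\<close>. Otherwise let \<open>e \<in> ker \<alpha>\<close> be orthogonal to \<open>I \<inter> ker \<alpha>\<close>. Then \<open>[e, Je] = c Je\<close>, and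
  \<open>ad e\<close> is skew-Hermitian on the complement of \<open>\<xi>, e, Je\<close>. Moreover \<open>I\<close> contains a central vector
  \<open>\<xi> + t e\<close>. So the algebra is \<open>\<real> \<times> h\<^sub>i\<close> if \<open>c \<noteq> 0\<close>, and it is again one of the algebras
  \<open>\<real> \<ltimes> \<real>\<^sup>6\<close> if \<open>c = 0\<close>.

  The entries are told apart by the non-zero eigenvalues of \<open>(ad x)\<^sup>2\<close>, counted with multiplicity,
  which for \<open>\<real>x \<ltimes>\<^sub>A \<real>\<^sup>d\<close> are those of \<open>A\<^sup>2\<close> up to a common factor \<open>s\<^sup>2\<close>.\<close>

section \<open>Linear algebra\<close>

lemma dim_image_inj:
  fixes f :: "'a::real_vector \<Rightarrow> 'b::real_vector"
  assumes "linear f" "inj f"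
  shows "dim (f ` S) = dim S"
proof -
  obtain B where B: "B \<subseteq> S" "independent B" "S \<subseteq> span B" "card B = dim S"
    using basis_exists by blast
  show ?thesis
  proof (rule dim_unique)
    show "f ` B \<subseteq> f ` S" using B by blast
    show "f ` S \<subseteq> span (f ` B)"
      using B(3) assms(1) by (metis image_mono linear_span_image)
    show "independent (f ` B)"
      using B(2) assms linear_independent_injective_image inj_on_subset by blast
    show "card (f ` B) = dim S"
      using B(4) assms(2) by (metis card_image inj_on_subset top_greatest)
  qed
qed

lemma linear_bij_inv:
  fixes f :: "'a::real_vector \<Rightarrow> 'b::real_vector"
  assumes "linear f" "bij f"
  shows "linear (inv f)" "bij (inv f)"
proof -
  have f: "f (inv f y) = y" for y using assms(2) by (simp add: bij_is_surj surj_f_inv_f)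
  have i: "inv f (f x) = x" for x using assms(2) by (simp add: bij_is_inj)
  show "linear (inv f)"
  proof (rule linearI)
    fix x y c
    show "inv f (x + y) = inv f x + inv f y"
      using linear_add[OF assms(1), of "inv f x" "inv f y"] i by (metis f)
    show "inv f (c *\<^sub>R x) = c *\<^sub>R inv f x"
      using linear_scale[OF assms(1), of c "inv f x"] i by (metis f)
  qed
  show "bij (inv f)" using assms(2) by (rule bij_imp_bij_inv)
qed

text \<open>The carrier is a bare \<open>real_vector\<close> without topology. Compactness and
  dimension arguments are carried out in \<open>'e\<close> and transported along such a
  bijection.\<close>

lemma ex_linear_bij_euclidean:
  assumes "dim (UNIV :: 'a::real_vector set) = DIM('e::euclidean_space)"
  shows "\<exists>\<phi>::'e \<Rightarrow> 'a. linear \<phi> \<and> bij \<phi>"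
proof -
  obtain B :: "'a set" where B: "independent B" "UNIV \<subseteq> span B" "card B = DIM('e)"
    using basis_exists[of "UNIV :: 'a set"] assms by auto
  have finB: "finite B" using B(3) by (metis DIM_positive card.infinite less_numeral_extra(3))
  obtain f where f: "bij_betw f (Basis :: 'e set) B"
    using finB B(3) by (metis bij_betw_iff_card finite_Basis)
  define \<phi> :: "'e \<Rightarrow> 'a" where "\<phi> v = (\<Sum>b\<in>Basis. (v \<bullet> b) *\<^sub>R f b)" for v
  have lin: "linear \<phi>"
    unfolding \<phi>_def
    by (rule linearI) (simp_all add: inner_add_left scaleR_add_left sum.distrib scaleR_sum_right)
  have inj: "inj \<phi>"
  proof (rule linear_injective_0[OF lin, THEN iffD2], intro allI impI)
    fix v assume "\<phi> v = 0"
    then have "(\<Sum>b\<in>Basis. (v \<bullet> inv_into Basis f (f b)) *\<^sub>R f b) = 0"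
      using f by (simp add: \<phi>_def bij_betw_def)
    then have "(\<Sum>y\<in>B. (v \<bullet> inv_into Basis f y) *\<^sub>R y) = 0"
      using sum.reindex_bij_betw[OF f, of "\<lambda>y. (v \<bullet> inv_into Basis f y) *\<^sub>R y"] by simp
    then have "\<forall>y\<in>B. v \<bullet> inv_into Basis f y = 0"
      using independentD[OF B(1) finB subset_refl, of "\<lambda>y. v \<bullet> inv_into Basis f y"] by blast
    then have "\<forall>b\<in>Basis. v \<bullet> b = 0"
      using f by (auto simp: bij_betw_def)
    then show "v = 0" by (simp add: euclidean_all_zero_iff)
  qed
  have "surj \<phi>"
  proof -
    have "y \<in> range \<phi>" if "y \<in> B" for y
    proof -
      obtain b where b: "b \<in> Basis" "f b = y" using f \<open>y \<in> B\<close> by (metis bij_betw_def imageE)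
      have "\<phi> b = (\<Sum>b'\<in>Basis. (if b' = b then f b else 0))"
        unfolding \<phi>_def using b(1) by (intro sum.cong) (auto simp: inner_Basis)
      then have "\<phi> b = y" using b by simp
      then show ?thesis by blast
    qed
    moreover have "subspace (range \<phi>)" using lin by (rule linear_subspace_image) simp
    ultimately have "span B \<subseteq> range \<phi>" by (meson span_minimal subsetI)
    then show ?thesis using B(2) by auto
  qed
  with inj lin show ?thesis by (auto simp: bij_def)
qed

lemma bilinear_simps:
  assumes "bilinear h"
  shows "h (x + y) z = h x z + h y z" "h x (y + z) = h x y + h x z"
    "h (x - y) z = h x z - h y z" "h x (y - z) = h x y - h x z"
    "h (c *\<^sub>R x) z = c *\<^sub>R h x z" "h x (c *\<^sub>R z) = c *\<^sub>R h x z"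
    "h (- x) z = - h x z" "h x (- z) = - h x z" "h 0 z = 0" "h x 0 = 0"
  using assms
  by (simp_all add: bilinear_ladd bilinear_radd bilinear_lsub bilinear_rsub bilinear_lmul
      bilinear_rmul bilinear_lneg bilinear_rneg bilinear_lzero bilinear_rzero)

text \<open>Maximise the Rayleigh quotient of \<open>S\<close> on \<open>W\<close>. The compact
  sphere is that of the Euclidean norm on \<open>'e\<close>, not of \<open>g\<close>, so the
  quotient keeps its denominator.\<close>

lemma symmetric_has_eigenvector:
  fixes \<phi> :: "'e::euclidean_space \<Rightarrow> 'a::real_vector" and g W S
  assumes \<phi>: "linear \<phi>" "bij \<phi>"
    and g: "inner_product g"
    and W: "subspace (W :: 'a set)" "w0 \<in> W" "w0 \<noteq> 0"
    and S: "linear S" "\<And>u. u \<in> W \<Longrightarrow> S u \<in> W"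
    and sym: "\<And>u v. u \<in> W \<Longrightarrow> v \<in> W \<Longrightarrow> g (S u) v = g u (S v)"
  shows "\<exists>v\<in>W. \<exists>m. v \<noteq> 0 \<and> S v = m *\<^sub>R v"
proof -
  have bg: "bilinear g" and gc: "\<And>x y. g x y = g y x" and gp: "\<And>x. x \<noteq> 0 \<Longrightarrow> g x x > 0"
    using g by (auto simp: inner_product_def)
  note gs = bilinear_simps[OF bg]
  have \<phi>0: "\<phi> u = 0 \<longleftrightarrow> u = 0" for u
    using \<phi> by (metis bij_is_inj linear_injective_0 linear_0)
  define K where "K = {u. \<phi> u \<in> W} \<inter> sphere 0 1"
  have sub: "subspace {u. \<phi> u \<in> W}"
    using W(1) linear_subspace_vimage[OF \<phi>(1)] by (simp add: vimage_def)
  have "compact K"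
    unfolding K_def by (intro closed_Int_compact closed_subspace sub compact_sphere)
  moreover have normalize: "(1 / norm u) *\<^sub>R u \<in> K" if "\<phi> u \<in> W" "u \<noteq> 0" for u
    using that sub by (auto simp: K_def subspace_scale linear_scale[OF \<phi>(1)] W(1))
  moreover have "K \<noteq> {}"
  proof -
    have "\<phi> (inv \<phi> w0) = w0" using \<phi>(2) by (simp add: bij_is_surj surj_f_inv_f)
    moreover have "inv \<phi> w0 \<noteq> 0" using calculation \<phi>0[of "inv \<phi> w0"] W(3) by simp
    ultimately show ?thesis using normalize[of "inv \<phi> w0"] W(2) by (metis empty_iff)
  qed
  moreover have "continuous_on K (\<lambda>u. g (S (\<phi> u)) (\<phi> u) / g (\<phi> u) (\<phi> u))"
  proof -
    have b1: "bilinear (\<lambda>u v. g (S (\<phi> u)) (\<phi> v))" and b2: "bilinear (\<lambda>u v. g (\<phi> u) (\<phi> v))"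
      unfolding bilinear_def
      by (auto intro!: linearI simp: linear_add[OF \<phi>(1)] linear_scale[OF \<phi>(1)]
          linear_add[OF S(1)] linear_scale[OF S(1)] gs)
    have "g (\<phi> u) (\<phi> u) \<noteq> 0" if "u \<in> K" for u
      using that gp[of "\<phi> u"] \<phi>0[of u] by (auto simp: K_def)
    then show ?thesis
      using bilinear_continuous_on_compose[OF continuous_on_id continuous_on_id b1]
        bilinear_continuous_on_compose[OF continuous_on_id continuous_on_id b2]
      by (intro continuous_on_divide) auto
  qed
  ultimately obtain u0 where u0: "u0 \<in> K"
    and max: "\<And>u. u \<in> K \<Longrightarrow> g (S (\<phi> u)) (\<phi> u) / g (\<phi> u) (\<phi> u)
        \<le> g (S (\<phi> u0)) (\<phi> u0) / g (\<phi> u0) (\<phi> u0)"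
    using continuous_attains_sup by (metis (no_types, lifting))
  define v where "v = \<phi> u0"
  define m where "m = g (S v) v / g v v"
  \<comment> \<open>Since \<open>m\<close> is the maximum of the quotient, this form is positive
    semidefinite on \<open>W\<close>, and it vanishes at \<open>v\<close>.\<close>
  define B where "B x y = m * g x y - g (S x) y" for x y
  have v: "v \<in> W" "v \<noteq> 0" using u0 \<phi>0[of u0] by (auto simp: K_def v_def)
  have Bv: "B v v = 0" using gp[OF v(2)] by (simp add: B_def m_def)
  have B_nonneg: "B y y \<ge> 0" if "y \<in> W" for y
  proof (cases "y = 0")
    case True then show ?thesis by (simp add: B_def gs)
  next
    case False
    define u where "u = inv \<phi> y"
    have y: "\<phi> u = y" using \<phi>(2) by (simp add: u_def bij_is_surj surj_f_inv_f)
    have "u \<noteq> 0" using False y \<phi>0 by auto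
    define c where "c = 1 / norm u"
    have c: "c > 0" using \<open>u \<noteq> 0\<close> by (simp add: c_def)
    have "g (S (c *\<^sub>R y)) (c *\<^sub>R y) / g (c *\<^sub>R y) (c *\<^sub>R y) \<le> m"
      using max[OF normalize[of u]] that y \<open>u \<noteq> 0\<close>
      by (simp add: linear_scale[OF \<phi>(1)] m_def v_def c_def)
    then have "g (S y) y / g y y \<le> m"
      using c by (simp add: linear_scale[OF S(1)] gs)
    then show ?thesis using gp[OF False] by (simp add: B_def divide_le_eq)
  qed
  define y where "y = m *\<^sub>R v - S v"
  have yW: "y \<in> W" unfolding y_def using v W(1) S(2) by (simp add: subspace_diff subspace_scale)
  have "B v y = g (m *\<^sub>R v - S v) y" by (simp add: B_def gs)
  then have Bvy: "B v y = g y y" by (simp only: y_def[symmetric])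
  have "B y v = g y (m *\<^sub>R v - S v)" using sym[OF yW v(1)] by (simp add: B_def gs)
  then have Byv: "B y v = g y y" by (simp only: y_def[symmetric])
  \<comment> \<open>A positive semidefinite form that vanishes at \<open>v\<close> has \<open>v\<close> in its kernel.\<close>
  have "0 \<le> 2 * t * g y y + t\<^sup>2 * B y y" for t
  proof -
    have "0 \<le> B (v + t *\<^sub>R y) (v + t *\<^sub>R y)"
      using v(1) yW W(1) by (intro B_nonneg) (simp add: subspace_add subspace_scale)
    also have "\<dots> = B v v + t * B v y + t * B y v + t\<^sup>2 * B y y"
      by (simp add: B_def gs linear_add[OF S(1)] linear_scale[OF S(1)] algebra_simps power2_eq_square)
    finally show ?thesis using Bv Bvy Byv by simp
  qed
  note q = this
  have "g y y \<le> 0"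
  proof (rule ccontr)
    assume "\<not> g y y \<le> 0"
    then have p: "g y y > 0" by simp
    \<comment> \<open>The lower bound is a polynomial in \<open>t\<close>: linear if
      \<open>B y y = 0\<close>, otherwise a parabola with minimum at \<open>- g y y / B y y\<close>.
      Either takes a negative value when \<open>g y y > 0\<close>.\<close>
    show False
    proof (cases "B y y = 0")
      case True then show False using q[of "-1"] p by simp
    next
      case False
      then have b: "B y y > 0" using B_nonneg[OF yW] by simp
      have "(g y y)\<^sup>2 / B y y > 0" using p b by simp
      moreover have "2 * (- g y y / B y y) * g y y + (- g y y / B y y)\<^sup>2 * B y y
          = - ((g y y)\<^sup>2 / B y y)"
        using b by (simp add: field_simps power2_eq_square)
      ultimately show False using q[of "- g y y / B y y"] by linarith
    qed
  qed
  then have "y = 0" using gp[of y] by force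
  then show ?thesis using v by (intro bexI[of _ v] exI[of _ m]) (auto simp: y_def)
qed

text \<open>\<open>T\<close> is the Gram map of \<open>g\<close> in coordinates: injective because
  \<open>g\<close> is positive definite, hence surjective.\<close>

lemma riesz_vector:
  assumes "dim (UNIV :: 'a::real_vector set) = DIM('e::euclidean_space)"
    and g: "inner_product g" and \<beta>: "linear (\<beta> :: 'a \<Rightarrow> real)"
  shows "\<exists>w. \<forall>u. \<beta> u = g w u"
proof -
  have bg: "bilinear g" and gp: "\<And>x. x \<noteq> 0 \<Longrightarrow> g x x > 0"
    using g by (auto simp: inner_product_def)
  note gs = bilinear_simps[OF bg]
  obtain \<phi> :: "'e \<Rightarrow> 'a" where \<phi>: "linear \<phi>" "bij \<phi>"
    using ex_linear_bij_euclidean[OF assms(1)] by blast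
  have \<phi>0: "\<phi> u = 0 \<longleftrightarrow> u = 0" for u
    using \<phi> by (metis bij_is_inj linear_injective_0 linear_0)
  define T :: "'e \<Rightarrow> 'e" where "T t = (\<Sum>b\<in>Basis. g (\<phi> t) (\<phi> b) *\<^sub>R b)" for t
  have T: "T t \<bullet> u = g (\<phi> t) (\<phi> u)" for t u
  proof -
    have lg: "linear (g (\<phi> t))" using bg by (simp add: bilinear_def)
    have "g (\<phi> t) (\<phi> u) = (g (\<phi> t) \<circ> \<phi>) (\<Sum>b\<in>Basis. (u \<bullet> b) *\<^sub>R b)"
      by (simp add: euclidean_representation)
    also have "\<dots> = (\<Sum>b\<in>Basis. (u \<bullet> b) *\<^sub>R (g (\<phi> t) \<circ> \<phi>) b)"
      using linear_compose[OF \<phi>(1) lg] by (simp only: linear_sum linear_scale)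
    finally show ?thesis
      by (simp add: T_def inner_sum_left inner_commute[of u] mult.commute)
  qed
  have lT: "linear T"
    unfolding T_def
    by (rule linearI)
      (simp_all add: linear_add[OF \<phi>(1)] linear_scale[OF \<phi>(1)] gs scaleR_add_left sum.distrib
        scaleR_sum_right)
  have "inj T"
  proof (rule linear_injective_0[OF lT, THEN iffD2], intro allI impI)
    fix t assume "T t = 0"
    then have "g (\<phi> t) (\<phi> t) = 0" using T[of t t] by simp
    then show "t = 0" using gp[of "\<phi> t"] \<phi>0 by force
  qed
  then have "surj T" using lT linear_inj_imp_surj by blast
  then obtain t where t: "T t = (\<Sum>b\<in>Basis. \<beta> (\<phi> b) *\<^sub>R b)" by (metis surjD)
  have "\<beta> u = g (\<phi> t) u" for u
  proof -
    obtain x where x: "u = \<phi> x" using \<phi>(2) by (metis bij_is_surj surjD)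
    have "\<beta> (\<phi> x) = (\<beta> \<circ> \<phi>) (\<Sum>b\<in>Basis. (x \<bullet> b) *\<^sub>R b)"
      by (simp add: euclidean_representation)
    also have "\<dots> = (\<Sum>b\<in>Basis. (x \<bullet> b) *\<^sub>R (\<beta> \<circ> \<phi>) b)"
      using linear_compose[OF \<phi>(1) \<beta>] by (simp only: linear_sum linear_scale)
    also have "\<dots> = T t \<bullet> x" by (simp add: t inner_sum_left inner_commute[of x] mult.commute)
    finally show ?thesis using T x by simp
  qed
  then show ?thesis by blast
qed

lemma lowdim_subset_kernel:
  fixes S :: "'a::real_vector set"
  assumes "dim (UNIV :: 'a set) = DIM('e::euclidean_space)" "dim S < DIM('e)"
  shows "\<exists>\<beta>. linear \<beta> \<and> (\<exists>u. \<beta> u \<noteq> (0::real)) \<and> (\<forall>u\<in>S. \<beta> u = 0)"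
proof -
  obtain \<phi> :: "'e \<Rightarrow> 'a" where \<phi>: "linear \<phi>" "bij \<phi>"
    using ex_linear_bij_euclidean[OF assms(1)] by blast
  have i: "linear (inv \<phi>)" "bij (inv \<phi>)" using linear_bij_inv[OF \<phi>] by auto
  have "dim (inv \<phi> ` S) < DIM('e)" using dim_image_inj[OF i(1)] i(2) assms(2) bij_is_inj by metis
  then obtain a where a: "a \<noteq> 0" "span (inv \<phi> ` S) \<subseteq> {x. a \<bullet> x = 0}"
    using lowdim_subset_hyperplane by blast
  have "linear (\<lambda>u. a \<bullet> inv \<phi> u)"
    by (rule linearI) (simp_all add: linear_add[OF i(1)] linear_scale[OF i(1)] inner_add_right)
  moreover have "a \<bullet> inv \<phi> (\<phi> a) \<noteq> 0" using a(1) \<phi>(2) by (simp add: bij_is_inj)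
  moreover have "\<forall>u\<in>S. a \<bullet> inv \<phi> u = 0" using a(2) by (auto intro: span_base)
  ultimately show ?thesis by blast
qed

text \<open>A non-zero functional vanishing on \<open>I\<close> has a proper kernel, whose dimension
  cannot exceed that of \<open>I\<close>.\<close>

lemma codim1_subspace_is_kernel:
  fixes I :: "'a::real_vector set"
  assumes d: "dim (UNIV :: 'a set) = DIM('e::euclidean_space)"
    and I: "subspace I" "dim I + 1 = DIM('e)"
  shows "\<exists>\<beta>. linear \<beta> \<and> (\<exists>u. \<beta> u \<noteq> (0::real)) \<and> I = {u. \<beta> u = 0}"
proof -
  obtain \<beta> u0 where \<beta>: "linear \<beta>" "\<beta> u0 \<noteq> (0::real)" "\<forall>u\<in>I. \<beta> u = 0"
    using lowdim_subset_kernel[OF d, of I] I(2) by auto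
  obtain \<phi> :: "'e \<Rightarrow> 'a" where \<phi>: "linear \<phi>" "bij \<phi>"
    using ex_linear_bij_euclidean[OF d] by blast
  have i: "linear (inv \<phi>)" "bij (inv \<phi>)" using linear_bij_inv[OF \<phi>] by auto
  let ?K = "{u. \<beta> u = 0}"
  have sK: "subspace ?K"
    using \<beta>(1) by (auto intro!: subspaceI simp: linear_0 linear_add linear_scale)
  have sub: "subspace (inv \<phi> ` I)" "subspace (inv \<phi> ` ?K)"
    using I(1) sK i(1) linear_subspace_image by blast+
  have "inv \<phi> ` ?K \<noteq> UNIV"
    using \<beta>(2) i(2) by (metis (mono_tags, lifting) UNIV_I bij_is_inj inj_image_mem_iff mem_Collect_eq)
  then have "dim (inv \<phi> ` ?K) < DIM('e)"
    using sub(2) by (metis dim_eq_full dim_subset_UNIV le_neq_implies_less span_eq_iff)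
  then have "dim (inv \<phi> ` ?K) \<le> dim (inv \<phi> ` I)"
    using I(2) dim_image_inj[OF i(1) bij_is_inj[OF i(2)]] by simp
  then have "inv \<phi> ` I = inv \<phi> ` ?K"
    using \<beta>(3) sub by (intro subspace_dim_equal) auto
  then have "I = ?K" using i(2) by (metis bij_is_inj inj_image_eq_iff)
  with \<beta> show ?thesis by blast
qed

text \<open>So few vectors lie in the kernel of a non-zero functional, and the vector representing
  it is orthogonal to them.\<close>

lemma ex_orthogonal_vector:
  fixes S :: "'a::real_vector set"
  assumes d: "dim (UNIV :: 'a set) = DIM('e::euclidean_space)" and g: "inner_product g"
    and S: "finite S" "card S < DIM('e)"
  shows "\<exists>u. u \<noteq> 0 \<and> (\<forall>s\<in>S. g s u = 0)"
proof -
  have bg: "bilinear g" and gc: "\<And>x y. g x y = g y x"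
    using g by (auto simp: inner_product_def)
  have "dim S < DIM('e)" using S dim_le_card' by (metis le_less_trans)
  then obtain \<beta> u where \<beta>: "linear \<beta>" "\<beta> u \<noteq> (0::real)" "\<forall>u\<in>S. \<beta> u = 0"
    using lowdim_subset_kernel[OF d, of S] by blast
  obtain w where "\<And>u. \<beta> u = g w u" using riesz_vector[OF d g \<beta>(1)] by blast
  then show ?thesis using \<beta> bilinear_simps(9)[OF bg] gc by metis
qed

section \<open>Isomorphisms of the model algebras\<close>

lemma lie_iso_refl: "lie_iso br br"
  unfolding lie_iso_def by (intro exI[of _ "\<lambda>x. x"]) (simp add: linear_id[unfolded id_def] bij_id[unfolded id_def])

lemma lie_iso_sym:
  assumes "lie_iso br br'" shows "lie_iso br' br"
proof -
  obtain f where f: "linear f" "bij f" "\<And>x y. f (br x y) = br' (f x) (f y)"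
    using assms by (auto simp: lie_iso_def)
  have fi: "f (inv f y) = y" for y using f(2) by (simp add: bij_is_surj surj_f_inv_f)
  have "inv f (br' x y) = br (inv f x) (inv f y)" for x y
    using f(3)[of "inv f x" "inv f y"] fi f(2) by (simp add: bij_is_inj inv_f_eq)
  then show ?thesis unfolding lie_iso_def using linear_bij_inv[OF f(1,2)] by blast
qed

lemma lie_iso_trans:
  assumes "lie_iso br br'" "lie_iso br' br''" shows "lie_iso br br''"
proof -
  obtain f where f: "linear f" "bij f" "\<And>x y. f (br x y) = br' (f x) (f y)"
    using assms(1) by (auto simp: lie_iso_def)
  obtain h where h: "linear h" "bij h" "\<And>x y. h (br' x y) = br'' (h x) (h y)"
    using assms(2) by (auto simp: lie_iso_def)
  show ?thesis unfolding lie_iso_def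
    using linear_compose[OF f(1) h(1)] bij_comp[OF f(2) h(2)] f(3) h(3)
    by (intro exI[of _ "h \<circ> f"]) simp
qed

lemma bij_map_prod_ident:
  assumes "bij f" shows "bij (map_prod (\<lambda>r. r) f)"
  using assms by (intro o_bij[of "map_prod (\<lambda>r. r) (inv f)"])
    (auto simp: fun_eq_iff bij_is_inj bij_is_surj surj_f_inv_f)

lemma lie_iso_R_times:
  assumes "lie_iso br br'" shows "lie_iso (R_times br) (R_times br')"
proof -
  obtain f where f: "linear f" "bij f" "\<And>x y. f (br x y) = br' (f x) (f y)"
    using assms by (auto simp: lie_iso_def)
  let ?F = "map_prod (\<lambda>r::real. r) f"
  have "linear ?F"
    by (rule linearI) (auto simp: map_prod_def linear_add[OF f(1)] linear_scale[OF f(1)] split: prod.splits)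
  moreover have "bij ?F"
    using f(2) by (rule bij_map_prod_ident)
  ultimately show ?thesis
    unfolding lie_iso_def
    by (intro exI[of _ ?F]) (simp add: f(3) R_times_def direct_product_def abelian_bracket_def)
qed

lemma semidirect_0: "semidirect 0 = abelian_bracket"
  by (intro ext) (simp add: semidirect_def abelian_bracket_def zero_prod_def)

lemma lie_iso_semidirect_reindex:
  fixes A :: "real^'n^'n" and B :: "real^'m^'m"
  assumes \<pi>: "bij \<pi>" and AB: "\<And>i j. A $ \<pi> i $ \<pi> j = B $ i $ j"
  shows "lie_iso (semidirect A) (semidirect B)"
proof -
  define P :: "real^'n \<Rightarrow> real^'m" where "P v = (\<chi> i. v $ \<pi> i)" for v
  let ?F = "map_prod (\<lambda>r::real. r) P"
  have lP: "linear P"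
    by (rule linearI) (simp_all add: P_def vec_eq_iff)
  have bP: "bij P"
  proof (rule o_bij)
    define Q :: "real^'m \<Rightarrow> real^'n" where "Q v = (\<chi> i. v $ inv \<pi> i)" for v
    show "Q \<circ> P = id" "P \<circ> Q = id"
      using \<pi> by (auto simp: fun_eq_iff vec_eq_iff P_def Q_def bij_is_inj bij_is_surj surj_f_inv_f)
  qed
  have PA: "P (A *v v) = B *v P v" for v
  proof (simp add: vec_eq_iff P_def matrix_vector_mult_def, intro allI)
    fix i
    show "(\<Sum>j\<in>UNIV. A $ \<pi> i $ j * v $ j) = (\<Sum>j\<in>UNIV. B $ i $ j * v $ \<pi> j)"
      using sum.reindex_bij_betw[OF \<pi>, of "\<lambda>j. A $ \<pi> i $ j * v $ j"] by (simp add: AB)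
  qed
  have "linear ?F"
    by (rule linearI) (auto simp: map_prod_def linear_add[OF lP] linear_scale[OF lP] split: prod.splits)
  moreover have "bij ?F"
    using bP by (rule bij_map_prod_ident)
  ultimately show ?thesis
    unfolding lie_iso_def
    by (intro exI[of _ ?F])
      (simp add: semidirect_def PA linear_diff[OF lP] linear_scale[OF lP])
qed

text \<open>The generator outside the ideal is rescaled: \<open>(1 / t, 0)\<close> acts through
  \<open>t *\<^sub>R A\<close> as \<open>(1, 0)\<close> does through \<open>A\<close>.\<close>

lemma lie_iso_semidirect_scale:
  fixes A :: "real^'n^'n"
  assumes "t \<noteq> 0"
  shows "lie_iso (semidirect A) (semidirect (t *\<^sub>R A))"
proof -
  let ?F = "\<lambda>p::real \<times> (real^'n). (fst p / t, snd p)"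
  have "linear ?F"
    by (rule linearI) (simp_all add: add_divide_distrib)
  moreover have "bij ?F"
    by (rule o_bij[of "\<lambda>p. (t * fst p, snd p)"]) (use assms in \<open>auto simp: fun_eq_iff\<close>)
  ultimately show ?thesis
    unfolding lie_iso_def
    by (intro exI[of _ ?F]) (use assms in \<open>simp add: semidirect_def scaleR_matrix_vector_assoc[symmetric]\<close>)
qed

text \<open>The zero block is a central coordinate of the ideal, so it splits off as a
  one-dimensional factor.\<close>

lemma lie_iso_R_times_semidirect:
  "lie_iso (semidirect (mat 0 \<oplus>\<^sub>m A :: real^(1+'n)^(1+'n))) (R_times (semidirect (A :: real^'n^'n)))"
proof -
  define F :: "real \<times> (real^(1+'n)) \<Rightarrow> real \<times> (real \<times> (real^'n))"
    where "F p = (snd p $ Inl 1, fst p, \<chi> i. snd p $ Inr i)" for p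
  define G :: "real \<times> (real \<times> (real^'n)) \<Rightarrow> real \<times> (real^(1+'n))"
    where "G p = (fst (snd p), \<chi> i. case i of Inl _ \<Rightarrow> fst p | Inr j \<Rightarrow> snd (snd p) $ j)" for p
  have "linear F" by (rule linearI) (simp_all add: F_def vec_eq_iff)
  moreover have "bij F"
  proof (rule o_bij)
    show "G \<circ> F = id"
      by (auto simp: fun_eq_iff F_def G_def vec_eq_iff num1_eq1 split: sum.split)
    show "F \<circ> G = id" by (auto simp: fun_eq_iff F_def G_def vec_eq_iff)
  qed
  moreover have "F (semidirect (mat 0 \<oplus>\<^sub>m A) p q) = R_times (semidirect A) (F p) (F q)" for p q
    by (simp add: F_def R_times_def direct_product_def abelian_bracket_def semidirect_def vec_eq_iff
        matrix_vector_mult_def block_sum_def UNIV_Plus_UNIV[symmetric] sum.Plus mat_def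
        del: UNIV_Plus_UNIV)
  ultimately show ?thesis unfolding lie_iso_def by blast
qed

lemma bij_involution: "(\<And>x. f (f x) = x) \<Longrightarrow> bij f"
  by (rule o_bij[of f]) auto

text \<open>The exchanged blocks share their index type, so the permutation of indices is an
  involution and thereby bijective.\<close>

lemma lie_iso_swap_outer:
  "lie_iso (semidirect (A \<oplus>\<^sub>m B \<oplus>\<^sub>m C)) (semidirect (B \<oplus>\<^sub>m (A :: real^'n^'n) \<oplus>\<^sub>m C))"
  for B :: "real^'n^'n"
  by (rule lie_iso_semidirect_reindex
      [where \<pi> = "case_sum (\<lambda>i. Inr (Inl i)) (case_sum Inl (\<lambda>i. Inr (Inr i)))"])
    (auto intro!: bij_involution simp: block_sum_def split: sum.split)

lemma lie_iso_swap_inner: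
  "lie_iso (semidirect (A \<oplus>\<^sub>m B \<oplus>\<^sub>m C)) (semidirect (A \<oplus>\<^sub>m (C :: real^'n^'n) \<oplus>\<^sub>m B))"
  for B :: "real^'n^'n"
  by (rule lie_iso_semidirect_reindex
      [where \<pi> = "case_sum Inl (case_sum (\<lambda>i. Inr (Inr i)) (\<lambda>i. Inr (Inl i)))"])
    (auto intro!: bij_involution simp: block_sum_def split: sum.split)

lemma scaleR_block_sum: "t *\<^sub>R (A \<oplus>\<^sub>m B) = t *\<^sub>R A \<oplus>\<^sub>m t *\<^sub>R B"
  by (simp add: vec_eq_iff block_sum_def split: sum.split)

lemma scaleR_Rmat: "t *\<^sub>R Rmat a = Rmat (t * a)"
  by (simp add: vec_eq_iff Rmat_def forall_2)

lemma rot_scale: "t \<noteq> 0 \<Longrightarrow> lie_iso (rot a b c) (rot (t * a) (t * b) (t * c))"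
  unfolding rot_def by (simp flip: scaleR_block_sum scaleR_Rmat add: lie_iso_semidirect_scale)

lemma rot_0: "rot 0 0 0 = abelian_bracket"
proof -
  have "Rmat 0 \<oplus>\<^sub>m Rmat 0 \<oplus>\<^sub>m Rmat 0 = 0"
    by (simp add: vec_eq_iff Rmat_def forall_2 block_sum_def split: sum.split)
  then show ?thesis by (simp add: rot_def semidirect_0)
qed

lemma rot_sort:
  assumes "0 \<le> a" "0 \<le> b" "0 \<le> c"
  shows "\<exists>a' b' c'. a' \<ge> b' \<and> b' \<ge> c' \<and> c' \<ge> 0 \<and> lie_iso (rot a b c) (rot a' b' c')"
proof -
  \<comment> \<open>Two adjacent transpositions; their products of length two and three in
    \<open>2\<close> and \<open>3\<close> complete the permutations of three blocks.\<close>
  have 1: "lie_iso (rot a b c) (rot b a c)" "lie_iso (rot a b c) (rot a c b)" for a b c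
    unfolding rot_def by (rule lie_iso_swap_outer lie_iso_swap_inner)+
  note 2 = lie_iso_trans[OF 1(1) 1(2)] lie_iso_trans[OF 1(2) 1(1)]
  note 3 = lie_iso_trans[OF 2(1) 1(1)]
  consider "a \<ge> b \<and> b \<ge> c" | "a \<ge> c \<and> c \<ge> b" | "b \<ge> a \<and> a \<ge> c" | "b \<ge> c \<and> c \<ge> a"
    | "c \<ge> a \<and> a \<ge> b" | "c \<ge> b \<and> b \<ge> a" by linarith
  then show ?thesis
    by cases (use assms in \<open>blast intro: 1 2 3 lie_iso_refl\<close>)+
qed

section \<open>The spectrum of \<open>(ad x)\<^sup>2\<close> as an invariant\<close>

definition sq_eigdim :: "('a::real_vector \<Rightarrow> 'a \<Rightarrow> 'a) \<Rightarrow> 'a \<Rightarrow> real \<Rightarrow> nat" where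
  "sq_eigdim br x \<mu> = dim {y. br x (br x y) = \<mu> *\<^sub>R y}"

text \<open>In \<open>\<real>x \<ltimes>\<^sub>A \<real>\<^sup>d\<close> every element acts on \<open>\<real>\<^sup>d\<close> by a multiple of \<open>A\<close>. Only the non-zero
  eigenvalues are recorded, as the element \<open>x\<close> itself contributes to the kernel.\<close>

definition has_spectrum :: "('a::real_vector \<Rightarrow> 'a \<Rightarrow> 'a) \<Rightarrow> real multiset \<Rightarrow> bool" where
  "has_spectrum br L \<longleftrightarrow>
     (\<forall>x. \<exists>s. \<forall>\<mu>. \<mu> \<noteq> 0 \<longrightarrow> sq_eigdim br x \<mu> = count (image_mset (\<lambda>d. s\<^sup>2 * d) L) \<mu>) \<and>
     (\<exists>x. \<forall>\<mu>. \<mu> \<noteq> 0 \<longrightarrow> sq_eigdim br x \<mu> = count L \<mu>)"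

text \<open>Zeros stay zero under scaling and are never counted at \<open>\<mu> \<noteq> 0\<close>.
  Deleting them puts a spectrum into the form of \<open>entry_spectrum\<close>.\<close>

lemma has_spectrum_nonzero:
  assumes "has_spectrum br L" shows "has_spectrum br {#d \<in># L. d \<noteq> 0#}"
proof -
  have "count (image_mset (\<lambda>d. s\<^sup>2 * d) {#d \<in># L. d \<noteq> 0#}) \<mu> = count (image_mset (\<lambda>d. s\<^sup>2 * d) L) \<mu>"
    if "\<mu> \<noteq> 0" for s \<mu> using that by (induction L) auto
  with assms show ?thesis by (simp add: has_spectrum_def)
qed

text \<open>An isomorphism conjugates \<open>ad x\<close> into \<open>ad (f x)\<close> and so
  carries the eigenspaces of the squares onto each other.\<close>

lemma has_spectrum_iso:
  assumes "lie_iso br br'" "has_spectrum br' L"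
  shows "has_spectrum br L"
proof -
  obtain f where f: "linear f" "bij f" "\<And>x y. f (br x y) = br' (f x) (f y)"
    using assms(1) by (auto simp: lie_iso_def)
  have eq: "sq_eigdim br x \<mu> = sq_eigdim br' (f x) \<mu>" for x \<mu>
  proof -
    have "f ` {y. br x (br x y) = \<mu> *\<^sub>R y} = {y. br' (f x) (br' (f x) y) = \<mu> *\<^sub>R y}"
    proof (intro set_eqI iffI)
      fix y assume "y \<in> {y. br' (f x) (br' (f x) y) = \<mu> *\<^sub>R y}"
      moreover obtain z where "y = f z" using f(2) by (metis bij_is_surj surjD)
      ultimately have "f (br x (br x z)) = f (\<mu> *\<^sub>R z)"
        by (simp add: f(3) linear_scale[OF f(1)])
      then show "y \<in> f ` {y. br x (br x y) = \<mu> *\<^sub>R y}"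
        using \<open>y = f z\<close> bij_is_inj[OF f(2)] by (simp add: inj_eq)
    qed (auto simp: f(3)[symmetric] linear_scale[OF f(1)])
    then show ?thesis
      unfolding sq_eigdim_def using dim_image_inj[OF f(1) bij_is_inj[OF f(2)]] by metis
  qed
  obtain x' where "\<forall>\<mu>. \<mu> \<noteq> 0 \<longrightarrow> sq_eigdim br' x' \<mu> = count L \<mu>"
    using assms(2) by (auto simp: has_spectrum_def)
  moreover obtain x where "x' = f x" using f(2) by (metis bij_is_surj surjD)
  ultimately show ?thesis using assms(2) by (auto simp: has_spectrum_def eq)
qed

text \<open>Squares are taken because \<open>R(a)\<close> with \<open>a \<noteq> 0\<close> has no
  real eigenvector, whereas its square is the scalar \<open>- a\<^sup>2\<close>.\<close>

definition sq_diagonal :: "real^'n^'n \<Rightarrow> ('n \<Rightarrow> real) \<Rightarrow> bool" where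
  "sq_diagonal A d \<longleftrightarrow> (\<forall>v i. (A *v (A *v v)) $ i = d i * v $ i)"

lemma sq_diagonal_Rmat: "sq_diagonal (Rmat a) (\<lambda>_. - a\<^sup>2)"
  by (simp add: sq_diagonal_def Rmat_def matrix_vector_mult_def UNIV_2 forall_2 power2_eq_square)

lemma sq_diagonal_mat: "sq_diagonal (mat c) (\<lambda>_. c\<^sup>2)"
  by (simp add: sq_diagonal_def mat_def matrix_vector_mult_def if_distrib[of "\<lambda>x. x * _"]
      power2_eq_square cong: if_cong)

lemma block_sum_mult_Inl: "((A \<oplus>\<^sub>m B) *v v) $ Inl i = (A *v (\<chi> j. v $ Inl j)) $ i"
  and block_sum_mult_Inr: "((A \<oplus>\<^sub>m B) *v v) $ Inr i' = (B *v (\<chi> j. v $ Inr j)) $ i'"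
  by (simp_all add: matrix_vector_mult_def block_sum_def UNIV_Plus_UNIV[symmetric] sum.Plus
      del: UNIV_Plus_UNIV)

lemma sq_diagonal_block_sum:
  assumes "sq_diagonal A d" "sq_diagonal B e"
  shows "sq_diagonal (A \<oplus>\<^sub>m B) (case_sum d e)"
  using assms
  by (auto simp: sq_diagonal_def block_sum_mult_Inl block_sum_mult_Inr split: sum.split)

text \<open>On the ideal, \<open>(s, u)\<close> acts as \<open>s *\<^sub>R A\<close>, so its square
  is diagonal with entries \<open>s\<^sup>2 * d i\<close>. Each eigenspace is a coordinate subspace,
  and its dimension counts indices.\<close>

lemma has_spectrum_semidirect:
  fixes A :: "real^'n^'n"
  assumes "sq_diagonal A d"
  shows "has_spectrum (semidirect A) (image_mset d (mset_set UNIV))"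
proof -
  have dims: "sq_eigdim (semidirect A) (s, u) \<mu> = count (image_mset (\<lambda>i. s\<^sup>2 * d i) (mset_set UNIV)) \<mu>"
    if "\<mu> \<noteq> 0" for s u \<mu>
  proof -
    let ?V = "{v::real^'n. \<forall>i. s\<^sup>2 * d i \<noteq> \<mu> \<longrightarrow> v $ i = 0}"
    have sq: "semidirect A (s, u) (semidirect A (s, u) (0, v)) = (0, \<chi> i. s\<^sup>2 * d i * v $ i)" for v
      using assms by (simp add: semidirect_def sq_diagonal_def vec_eq_iff matrix_vector_mult_scaleR
          power2_eq_square)
    have "{y. semidirect A (s, u) (semidirect A (s, u) y) = \<mu> *\<^sub>R y} = Pair 0 ` ?V"
    proof (intro set_eqI iffI)
      fix y :: "real \<times> (real^'n)"
      assume y: "y \<in> {y. semidirect A (s, u) (semidirect A (s, u) y) = \<mu> *\<^sub>R y}"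
      then have "\<mu> *\<^sub>R y = semidirect A (s, u) (semidirect A (s, u) y)" by simp
      \<comment> \<open>Brackets lie in the ideal, so an eigenvector for a non-zero eigenvalue does
        too.\<close>
      then have "fst (\<mu> *\<^sub>R y) = 0" by (simp only: semidirect_def fst_conv)
      then obtain v where v: "y = (0, v)" using \<open>\<mu> \<noteq> 0\<close> by (cases y) auto
      then have "\<forall>i. s\<^sup>2 * d i * v $ i = \<mu> * v $ i"
        using y sq[of v] by (simp add: vec_eq_iff)
      then show "y \<in> Pair 0 ` ?V" using v by auto
    next
      fix y :: "real \<times> (real^'n)"
      assume "y \<in> Pair 0 ` ?V"
      then show "y \<in> {y. semidirect A (s, u) (semidirect A (s, u) y) = \<mu> *\<^sub>R y}"
        using sq by (auto simp: vec_eq_iff)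
    qed
    then have "sq_eigdim (semidirect A) (s, u) \<mu> = dim ?V"
      unfolding sq_eigdim_def
      by (simp add: dim_image_inj[of "Pair 0"] linearI inj_on_def)
    also have "\<dots> = card {i. s\<^sup>2 * d i = \<mu>}"
      using dim_substandard_cart[where 'a = real, of "{i. s\<^sup>2 * d i = \<mu>}"] by (simp add: dim_vec_eq)
    also have "\<dots> = count (image_mset (\<lambda>i. s\<^sup>2 * d i) (mset_set UNIV)) \<mu>"
      by (simp add: count_image_mset vimage_def)
    finally show ?thesis .
  qed
  have "\<exists>s. \<forall>\<mu>. \<mu> \<noteq> 0 \<longrightarrow> sq_eigdim (semidirect A) x \<mu>
      = count (image_mset (\<lambda>d. s\<^sup>2 * d) (image_mset d (mset_set UNIV))) \<mu>" for x
    using dims[of _ "fst x" "snd x"] by (intro exI[of _ "fst x"]) (simp add: multiset.map_comp o_def)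
  moreover have "\<forall>\<mu>. \<mu> \<noteq> 0 \<longrightarrow> sq_eigdim (semidirect A) (1, 0) \<mu> = count (image_mset d (mset_set UNIV)) \<mu>"
    using dims[of _ 1 0] by simp
  ultimately show ?thesis unfolding has_spectrum_def by blast
qed

lemma image_mset_case_sum:
  "image_mset (case_sum d e) (mset_set (UNIV :: ('m::finite + 'n::finite) set))
     = image_mset d (mset_set UNIV) + image_mset e (mset_set UNIV)"
proof -
  have "mset_set (UNIV :: ('m + 'n) set) = image_mset Inl (mset_set UNIV) + image_mset Inr (mset_set UNIV)"
    by (subst UNIV_sum, subst mset_set_Union) (auto simp: image_mset_mset_set)
  then show ?thesis by (simp add: multiset.map_comp o_def)
qed

lemma image_mset_const_2: "image_mset (\<lambda>_. c) (mset_set (UNIV :: 2 set)) = {#c, c#}"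
  and image_mset_const_1: "image_mset (\<lambda>_. c') (mset_set (UNIV :: 1 set)) = {#c'#}"
  by (simp_all add: image_mset_const_eq) (simp add: numeral_eq_Suc)

lemma has_spectrum_rot: "has_spectrum (rot a b c) (mset [- a\<^sup>2, - a\<^sup>2, - b\<^sup>2, - b\<^sup>2, - c\<^sup>2, - c\<^sup>2])"
  unfolding rot_def
  using has_spectrum_semidirect[OF sq_diagonal_block_sum[OF sq_diagonal_Rmat[of a]
        sq_diagonal_block_sum[OF sq_diagonal_Rmat[of b] sq_diagonal_Rmat[of c]]]]
  by (simp add: image_mset_case_sum image_mset_const_2 add_mset_commute)

lemma h3_0: "h3 l 0 = h2 l" "h2 0 = h1"
  by (simp_all add: h1_def h2_def h3_def)

lemma R_times_h3: "lie_iso (semidirect ((mat 0 :: real^1^1) \<oplus>\<^sub>m (mat 1 :: real^1^1) \<oplus>\<^sub>m Rmat a \<oplus>\<^sub>m Rmat b)) (R_times (h3 a b))"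
  unfolding h3_def by (rule lie_iso_R_times_semidirect)

lemma has_spectrum_R_times_h3:
  "has_spectrum (R_times (h3 a b)) (mset [- a\<^sup>2, - a\<^sup>2, - b\<^sup>2, - b\<^sup>2, 0, 1])"
proof -
  \<comment> \<open>The values \<open>0\<^sup>2\<close> and \<open>1\<^sup>2\<close> are left
    unevaluated to match \<open>sq_diagonal_mat\<close>.\<close>
  have "sq_diagonal ((mat 0 :: real^1^1) \<oplus>\<^sub>m (mat 1 :: real^1^1) \<oplus>\<^sub>m Rmat a \<oplus>\<^sub>m Rmat b)
      (case_sum (\<lambda>_. 0\<^sup>2) (case_sum (\<lambda>_. 1\<^sup>2) (case_sum (\<lambda>_. - a\<^sup>2) (\<lambda>_. - b\<^sup>2))))"
    by (intro sq_diagonal_block_sum sq_diagonal_mat sq_diagonal_Rmat)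
  from has_spectrum_semidirect[OF this] show ?thesis
    by (intro has_spectrum_iso[OF lie_iso_sym[OF R_times_h3]])
      (simp add: image_mset_case_sum image_mset_const_2 image_mset_const_1 add_mset_commute)
qed

text \<open>The non-zero eigenvalues of \<open>(ad x)\<^sup>2\<close> for the standard
  \<open>x\<close>, in increasing order when the entry is admissible, so that equal multisets give
  equal lists.\<close>

fun entry_spectrum :: "entry \<Rightarrow> real list" where
  "entry_spectrum Abelian = []"
| "entry_spectrum Rot1 = [- 1, - 1]"
| "entry_spectrum (Rot2 l) = [- 1, - 1, - l\<^sup>2, - l\<^sup>2]"
| "entry_spectrum (Rot3 l a) = [- 1, - 1, - l\<^sup>2, - l\<^sup>2, - a\<^sup>2, - a\<^sup>2]"
| "entry_spectrum Prod1 = [1]"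
| "entry_spectrum (Prod2 l) = [- l\<^sup>2, - l\<^sup>2, 1]"
| "entry_spectrum (Prod3 l1 l2) = [- l1\<^sup>2, - l1\<^sup>2, - l2\<^sup>2, - l2\<^sup>2, 1]"

lemma iso_to_has_spectrum:
  assumes "admissible e" "iso_to br e" shows "has_spectrum br (mset (entry_spectrum e))"
proof -
  have rot: "has_spectrum br {#d \<in># mset [- a\<^sup>2, - a\<^sup>2, - b\<^sup>2, - b\<^sup>2, - c\<^sup>2, - c\<^sup>2]. d \<noteq> 0#}"
    if "lie_iso br (rot a b c)" for a b c
    using has_spectrum_iso[OF that has_spectrum_rot] by (rule has_spectrum_nonzero)
  have prod: "has_spectrum br {#d \<in># mset [- a\<^sup>2, - a\<^sup>2, - b\<^sup>2, - b\<^sup>2, 0, 1]. d \<noteq> 0#}"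
    if "lie_iso br (R_times (h3 a b))" for a b
    using has_spectrum_iso[OF that has_spectrum_R_times_h3] by (rule has_spectrum_nonzero)
  show ?thesis
  proof (cases e)
    case Abelian
    have "{y::real^7. abelian_bracket x (abelian_bracket x y) = \<mu> *\<^sub>R y} = {0}" if "\<mu> \<noteq> 0" for x and \<mu> :: real
      using that by (auto simp: abelian_bracket_def)
    then have "has_spectrum (abelian_bracket :: real^7 \<Rightarrow> _) {#}"
      by (simp add: has_spectrum_def sq_eigdim_def)
    then show ?thesis using assms Abelian has_spectrum_iso by auto
  next
    case Rot1
    then show ?thesis using rot[of 1 0 0] assms by simp
  next
    case (Rot2 l)
    then show ?thesis using rot[of 1 l 0] assms by simp
  next
    case (Rot3 l a)
    then show ?thesis using rot[of 1 l a] assms by simp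
  next
    case Prod1
    then show ?thesis using prod[of 0 0] assms by (simp add: h3_0)
  next
    case (Prod2 l)
    then show ?thesis using prod[of l 0] assms by (simp add: h3_0)
  next
    case (Prod3 l1 l2)
    then show ?thesis using prod[of l1 l2] assms by simp
  qed
qed

lemma sorted_entry_spectrum:
  assumes "admissible e" shows "sorted (entry_spectrum e)"
proof -
  have "- x\<^sup>2 \<le> 1" for x :: real by (rule order_trans[of _ 0]) auto
  then show ?thesis using assms by (cases e) (simp_all add: power_mono power_le_one)
qed

lemma zero_notin_entry_spectrum: "admissible e \<Longrightarrow> 0 \<notin> set (entry_spectrum e)"
  by (cases e) auto

text \<open>The seven lists have different lengths, which fixes the constructor. The fixed value
  \<open>- 1\<close> or \<open>1\<close> then forces \<open>s\<^sup>2 = 1\<close>, and positive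
  parameters are determined by their squares.\<close>

lemma entry_eqI:
  assumes "admissible e" "admissible e'"
    and "entry_spectrum e = map (\<lambda>d. s\<^sup>2 * d) (entry_spectrum e')"
  shows "e = e'"
  using assms by (cases e; cases e') (auto simp: power2_eq_iff_nonneg)

lemma entry_unique:
  assumes "admissible e" "admissible e'" "iso_to br e" "iso_to br e'"
  shows "e = e'"
proof -
  note sp = iso_to_has_spectrum[OF assms(1,3)] iso_to_has_spectrum[OF assms(2,4)]
  \<comment> \<open>Evaluate both spectra at an \<open>x\<close> where \<open>L\<close> is attained
    exactly; there \<open>L'\<close> holds up to a factor \<open>s\<^sup>2\<close>.\<close>
  have compare: "\<exists>s. \<forall>\<mu>. \<mu> \<noteq> 0 \<longrightarrow> count L \<mu> = count (image_mset (\<lambda>d. s\<^sup>2 * d) L') \<mu>"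
    if "has_spectrum br L" "has_spectrum br L'" for L L'
    using that unfolding has_spectrum_def by metis
  obtain s where s: "\<And>\<mu>. \<mu> \<noteq> 0 \<Longrightarrow> count (mset (entry_spectrum e)) \<mu>
      = count (image_mset (\<lambda>d. s\<^sup>2 * d) (mset (entry_spectrum e'))) \<mu>"
    using compare[OF sp] by blast
  obtain s' where s': "\<And>\<mu>. \<mu> \<noteq> 0 \<Longrightarrow> count (mset (entry_spectrum e')) \<mu>
      = count (image_mset (\<lambda>d. s'\<^sup>2 * d) (mset (entry_spectrum e))) \<mu>"
    using compare[OF sp(2,1)] by blast
  note z = zero_notin_entry_spectrum[OF assms(1)] zero_notin_entry_spectrum[OF assms(2)]
  \<comment> \<open>The factor may be zero. Then the first spectrum is empty, the reverse comparison
    through \<open>s'\<close> empties the second, and both entries are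
    \<open>Abelian\<close>.\<close>
  show ?thesis
  proof (cases "s = 0")
    case True
    have "count (mset (entry_spectrum e)) \<mu> = 0" for \<mu>
      using s[of \<mu>] True z(1) by (cases "\<mu> = 0") (auto simp: image_mset_const_eq count_eq_zero_iff)
    then have e: "entry_spectrum e = []" by (metis count_eq_zero_iff list.set_intros(1) neq_Nil_conv set_mset_mset)
    have "count (mset (entry_spectrum e')) \<mu> = 0" for \<mu>
      using s'[of \<mu>] e z(2) by (cases "\<mu> = 0") (auto simp: count_eq_zero_iff)
    then have e': "entry_spectrum e' = []" by (metis count_eq_zero_iff list.set_intros(1) neq_Nil_conv set_mset_mset)
    show ?thesis using e e' by (cases e; cases e') auto
  next
    case False
    \<comment> \<open>The counts are known to agree only at \<open>\<mu> \<noteq> 0\<close>; for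
      \<open>s \<noteq> 0\<close> neither multiset contains zero, so they agree everywhere.\<close>
    have "mset (entry_spectrum e) = mset (map (\<lambda>d. s\<^sup>2 * d) (entry_spectrum e'))"
    proof (rule multiset_eqI)
      fix \<mu>
      show "count (mset (entry_spectrum e)) \<mu> = count (mset (map (\<lambda>d. s\<^sup>2 * d) (entry_spectrum e'))) \<mu>"
      proof (cases "\<mu> = 0")
        case True
        then have "\<mu> \<notin> set (entry_spectrum e)" "\<mu> \<notin> set (map (\<lambda>d. s\<^sup>2 * d) (entry_spectrum e'))"
          using z False by auto
        then show ?thesis by (metis count_eq_zero_iff set_mset_mset)
      qed (use s in simp)
    qed
    moreover have "sorted (map (\<lambda>d. s\<^sup>2 * d) (entry_spectrum e'))"
      using sorted_entry_spectrum[OF assms(2)]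
      unfolding sorted_wrt_map by (rule sorted_wrt_mono_rel[rotated]) (simp add: mult_left_mono)
    ultimately have "entry_spectrum e = map (\<lambda>d. s\<^sup>2 * d) (entry_spectrum e')"
      using sorted_entry_spectrum[OF assms(1)] by (metis properties_for_sort sorted_sort_id)
    then show ?thesis using entry_eqI assms(1,2) by blast
  qed
qed

section \<open>Orthogonal bases adapted to a block matrix\<close>

definition orthogonal_family :: "('a::real_vector \<Rightarrow> 'a \<Rightarrow> real) \<Rightarrow> ('i \<Rightarrow> 'a) \<Rightarrow> bool" where
  "orthogonal_family g b \<longleftrightarrow> (\<forall>i. b i \<noteq> 0) \<and> (\<forall>i j. i \<noteq> j \<longrightarrow> g (b i) (b j) = 0)"

text \<open>The index order puts the coordinates of \<open>T (b i)\<close> into column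
  \<open>i\<close>, in accordance with \<open>*v\<close>.\<close>

definition acts :: "('a::real_vector \<Rightarrow> 'a) \<Rightarrow> real^'n^'n \<Rightarrow> ('n \<Rightarrow> 'a) \<Rightarrow> bool" where
  "acts T A b \<longleftrightarrow> (\<forall>i. T (b i) = (\<Sum>j\<in>UNIV. A $ j $ i *\<^sub>R b j))"

definition pair :: "'a \<Rightarrow> 'a \<Rightarrow> 2 \<Rightarrow> 'a" where
  "pair p q i = (if i = 1 then p else q)"

lemma orthogonal_family_case_sum:
  assumes "inner_product g" "orthogonal_family g b" "orthogonal_family g b'" "\<And>i j. g (b i) (b' j) = 0"
  shows "orthogonal_family g (case_sum b b')"
proof -
  have "g (b' j) (b i) = 0" for i j using assms(1,4) by (simp add: inner_product_def)
  then show ?thesis using assms(2-4) by (auto simp: orthogonal_family_def split: sum.split)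
qed

lemma orthogonal_family_pair:
  assumes "inner_product g" "p \<noteq> 0" "q \<noteq> 0" "g p q = 0"
  shows "orthogonal_family g (pair p q)"
  using assms by (simp add: orthogonal_family_def pair_def inner_product_def forall_2)

lemma acts_block_sum:
  assumes "acts T A b" "acts T B b'"
  shows "acts T (A \<oplus>\<^sub>m B) (case_sum b b')"
  using assms unfolding acts_def
  by (auto simp: block_sum_def UNIV_Plus_UNIV[symmetric] sum.Plus simp del: UNIV_Plus_UNIV split: sum.split)

lemma acts_pair: "T p = m *\<^sub>R q \<Longrightarrow> T q = - m *\<^sub>R p \<Longrightarrow> acts T (Rmat m) (pair p q)"
  by (simp add: acts_def forall_2 UNIV_2 Rmat_def pair_def)

lemma acts_mat: "T u = c *\<^sub>R u \<Longrightarrow> acts T (mat c :: real^1^1) (\<lambda>_. u)"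
  by (simp add: acts_def mat_def num1_eq1)

lemma (in lie_algebra) antisymmetric: "br x y = - br y x"
proof -
  note bs = bilinear_simps[OF bilinear_br]
  have "br (x + y) (x + y) = br x y + br y x"
    unfolding bs(1) bs(2) by (simp add: alternating)
  then show ?thesis by (simp add: alternating eq_neg_iff_add_eq_0)
qed

text \<open>Together with \<open>x\<close> the family consists of as many non-zero orthogonal
  vectors as the dimension, so it is a basis; in it the bracket is that of the semidirect
  product.\<close>

lemma lie_iso_orthogonal_basis:
  fixes br :: "'a::real_vector \<Rightarrow> 'a \<Rightarrow> 'a" and b :: "'n::finite \<Rightarrow> 'a"
  assumes lie: "lie_algebra br" and g: "inner_product g"
    and d: "dim (UNIV :: 'a set) = CARD('n) + 1"
    and x: "x \<noteq> 0" "\<And>i. g x (b i) = 0" and b: "orthogonal_family g b"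
    and abelian: "\<And>i j. br (b i) (b j) = 0" and act: "acts (br x) A b"
  shows "lie_iso br (semidirect A)"
proof -
  interpret lie_algebra br by (rule lie)
  note bs = bilinear_simps[OF bilinear_br]
  have bg: "bilinear g" and gc: "\<And>x y. g x y = g y x" and gp: "\<And>x. x \<noteq> 0 \<Longrightarrow> g x x > 0"
    using g by (auto simp: inner_product_def)
  note gs = bilinear_simps[OF bg]
  have lin: "linear (br y)" "linear (\<lambda>z. br z y)" "linear (g y)" "linear (\<lambda>z. g z y)" for y
    using bilinear_br bg by (auto simp: bilinear_def)
  define U where "U v = (\<Sum>i\<in>UNIV. v $ i *\<^sub>R b i)" for v :: "real^'n"
  define F where "F p = fst p *\<^sub>R x + U (snd p)" for p
  have lU: "linear U"
    unfolding U_def by (rule linearI) (simp_all add: scaleR_add_left sum.distrib scaleR_sum_right)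
  have lF: "linear F"
    by (rule linearI) (simp_all add: F_def linear_add[OF lU] linear_scale[OF lU] algebra_simps)
  have "inj F"
  proof (rule linear_injective_0[OF lF, THEN iffD2], intro allI impI)
    fix p assume p: "F p = 0"
    have xU: "g x (U v) = 0" for v
      by (simp add: U_def linear_sum[OF lin(3)] linear_scale[OF lin(3)] x(2))
    have "g x (F p) = fst p * g x x" by (simp add: F_def gs xU)
    then have 1: "fst p = 0" using p gp[OF x(1)] by (simp add: gs)
    have "snd p $ k = 0" for k
    proof -
      have "g (b k) (U (snd p)) = (\<Sum>i\<in>UNIV. if i = k then snd p $ k * g (b k) (b k) else 0)"
        unfolding U_def linear_sum[OF lin(3)] using b
        by (intro sum.cong) (auto simp: linear_scale[OF lin(3)] orthogonal_family_def)
      then have "snd p $ k * g (b k) (b k) = 0" using p 1 by (simp add: F_def gs)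
      then show ?thesis using gp[of "b k"] b by (auto simp: orthogonal_family_def)
    qed
    then show "p = 0" using 1 by (simp add: prod_eq_iff vec_eq_iff)
  qed
  moreover have "surj F"
  proof -
    obtain \<phi> :: "real \<times> (real^'n) \<Rightarrow> 'a" where \<phi>: "linear \<phi>" "bij \<phi>"
      using ex_linear_bij_euclidean[where 'e = "real \<times> (real^'n)" and 'a = 'a] d by auto
    note i = linear_bij_inv[OF \<phi>]
    \<comment> \<open>Surjectivity follows from the dimension count, applied to an injective
      endomorphism of a Euclidean space.\<close>
    have "inj (inv \<phi> \<circ> F)" using \<open>inj F\<close> bij_is_inj[OF i(2)] by (rule inj_compose[rotated])
    then have "surj (inv \<phi> \<circ> F)"
      using linear_compose[OF lF i(1)] linear_inj_imp_surj by blast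
    then have "surj (\<phi> \<circ> (inv \<phi> \<circ> F))" using bij_is_surj[OF \<phi>(2)] by (rule comp_surj)
    moreover have "\<phi> \<circ> (inv \<phi> \<circ> F) = F"
      using \<phi>(2) by (auto simp: fun_eq_iff bij_is_surj surj_f_inv_f)
    ultimately show ?thesis by simp
  qed
  moreover have "F (semidirect A p q) = br (F p) (F q)" for p q
  proof -
    have UU: "br (U v) (U w) = 0" for v w
      unfolding U_def
      by (simp add: linear_sum[OF lin(2)] linear_sum[OF lin(1)] linear_scale[OF lin(2)]
          linear_scale[OF lin(1)] abelian)
    have xU: "br x (U v) = U (A *v v)" for v
    proof -
      have "br x (U v) = (\<Sum>i\<in>UNIV. \<Sum>j\<in>UNIV. (A $ j $ i * v $ i) *\<^sub>R b j)"
        using act unfolding U_def acts_def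
        by (simp add: linear_sum[OF lin(1)] linear_scale[OF lin(1)] scaleR_sum_right mult.commute)
      also have "\<dots> = (\<Sum>j\<in>UNIV. \<Sum>i\<in>UNIV. (A $ j $ i * v $ i) *\<^sub>R b j)" by (rule sum.swap)
      finally show ?thesis by (simp add: U_def matrix_vector_mult_def scaleR_sum_left)
    qed
    have Ux: "br (U v) x = - U (A *v v)" for v using antisymmetric xU by metis
    show ?thesis
      by (simp add: F_def semidirect_def bs alternating UU xU Ux linear_diff[OF lU] linear_scale[OF lU])
  qed
  ultimately have "lie_iso (semidirect A) br"
    unfolding lie_iso_def bij_def using lF by blast
  then show ?thesis by (rule lie_iso_sym)
qed

text \<open>The relations are confined to \<open>W\<close> because the \<open>J\<close> of a
  coKaehler structure kills \<open>\<xi>\<close> and squares to \<open>- 1\<close> only on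
  \<open>ker \<alpha>\<close>.\<close>

definition skew_hermitian_on ::
    "('a::real_vector \<Rightarrow> 'a \<Rightarrow> real) \<Rightarrow> ('a \<Rightarrow> 'a) \<Rightarrow> ('a \<Rightarrow> 'a) \<Rightarrow> 'a set \<Rightarrow> bool" where
  "skew_hermitian_on g J D W \<longleftrightarrow> subspace W \<and>
     (\<forall>u\<in>W. J u \<in> W \<and> D u \<in> W \<and> J (J u) = - u \<and> D (J u) = J (D u)) \<and>
     (\<forall>u\<in>W. \<forall>v\<in>W. g (J u) (J v) = g u v \<and> g (D u) v = - g u (D v))"

text \<open>Writing subspaces as complements of finite sets reduces the existence of a further
  vector to a bound on a cardinality.\<close>

definition perp :: "('a \<Rightarrow> 'a \<Rightarrow> real) \<Rightarrow> 'a set \<Rightarrow> 'a set" where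
  "perp g S = {u. \<forall>s\<in>S. g s u = 0}"

text \<open>As \<open>J\<close> and \<open>D\<close> are skew and commute,
  \<open>J \<circ> D\<close> is symmetric and has an eigenvector \<open>v\<close>. The plane of
  \<open>v\<close> and \<open>J v\<close> is invariant under both operators, hence so is its
  complement.\<close>

lemma split_plane:
  fixes S :: "'a::real_vector set"
  assumes d: "dim (UNIV :: 'a set) = DIM('e::euclidean_space)" and g: "inner_product g"
    and J: "linear J" and D: "linear D" and W: "skew_hermitian_on g J D (perp g S)"
    and S: "finite S" "card S < DIM('e)"
  shows "\<exists>p q m. p \<in> perp g S \<and> q \<in> perp g S \<and> p \<noteq> 0 \<and> q \<noteq> 0 \<and> g p q = 0 \<and> m \<ge> 0 \<and>
    D p = m *\<^sub>R q \<and> D q = - m *\<^sub>R p \<and> skew_hermitian_on g J D (perp g (insert p (insert q S)))"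
proof -
  let ?W = "perp g S"
  have bg: "bilinear g" and gc: "\<And>x y. g x y = g y x" and gp: "\<And>x. x \<noteq> 0 \<Longrightarrow> g x x > 0"
    using g by (auto simp: inner_product_def)
  note gs = bilinear_simps[OF bg]
  have sW: "subspace ?W" and JW: "\<And>u. u \<in> ?W \<Longrightarrow> J u \<in> ?W" and DW: "\<And>u. u \<in> ?W \<Longrightarrow> D u \<in> ?W"
    and JJ: "\<And>u. u \<in> ?W \<Longrightarrow> J (J u) = - u" and DJ: "\<And>u. u \<in> ?W \<Longrightarrow> D (J u) = J (D u)"
    and iso: "\<And>u v. u \<in> ?W \<Longrightarrow> v \<in> ?W \<Longrightarrow> g (J u) (J v) = g u v"
    and skew: "\<And>u v. u \<in> ?W \<Longrightarrow> v \<in> ?W \<Longrightarrow> g (D u) v = - g u (D v)"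
    using W by (auto simp: skew_hermitian_on_def)
  have Jskew: "g (J u) v = - g u (J v)" if "u \<in> ?W" "v \<in> ?W" for u v
    using iso[OF JW[OF that(1)] that(2)] JJ[OF that(1)] by (simp add: gs)
  obtain w0 where w0: "w0 \<in> ?W" "w0 \<noteq> 0"
    using ex_orthogonal_vector[OF d g S] by (auto simp: perp_def)
  obtain \<phi> :: "'e \<Rightarrow> 'a" where \<phi>: "linear \<phi>" "bij \<phi>"
    using ex_linear_bij_euclidean[OF d] by blast
  have "\<exists>v\<in>?W. \<exists>m. v \<noteq> 0 \<and> (J \<circ> D) v = m *\<^sub>R v"
  proof (rule symmetric_has_eigenvector[OF \<phi> g sW w0])
    show "linear (J \<circ> D)" using D J by (rule linear_compose)
    show "(J \<circ> D) u \<in> ?W" if "u \<in> ?W" for u using that JW DW by simp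
    show "g ((J \<circ> D) u) v = g u ((J \<circ> D) v)" if "u \<in> ?W" "v \<in> ?W" for u v
      using that Jskew[of "D u" v] skew[of u "J v"] DJ[of v] JW DW by simp
  qed
  then obtain v m where v: "v \<in> ?W" "v \<noteq> 0" "J (D v) = m *\<^sub>R v" by auto
  have DJv: "D (J v) = m *\<^sub>R v" using DJ v by simp
  have "- D v = m *\<^sub>R J v"
    using JJ[OF DW[OF v(1)]] v(3) linear_scale[OF J] by metis
  then have Dv: "D v = - m *\<^sub>R J v" by (metis add.inverse_inverse scaleR_minus_left)
  have Jv: "J v \<noteq> 0" using JJ[OF v(1)] v(2) linear_0[OF J] by (metis neg_equal_0_iff_equal)
  have vJv: "g v (J v) = 0" "g (J v) v = 0" using Jskew[OF v(1) v(1)] gc[of v "J v"] by auto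
  have W': "skew_hermitian_on g J D (perp g (insert v (insert (J v) S)))"
    unfolding skew_hermitian_on_def
  proof (intro conjI ballI)
    let ?W' = "perp g (insert v (insert (J v) S))"
    show "subspace ?W'"
      unfolding perp_def by (rule subspaceI) (auto simp: gs)
    fix u assume "u \<in> ?W'"
    then have u: "u \<in> ?W" "g v u = 0" "g (J v) u = 0" by (auto simp: perp_def)
    have in_W': "w \<in> ?W'" if "w \<in> ?W" "g v w = 0" "g (J v) w = 0" for w
      using that by (auto simp: perp_def)
    show "J u \<in> ?W'"
      using u v JW Jskew[of v u] iso[of v u] by (intro in_W') auto
    show "D u \<in> ?W'"
      using u v JW DW skew[of v u] skew[of "J v" u] Dv DJv by (intro in_W') (auto simp: gs)
    show "J (J u) = - u" "D (J u) = J (D u)" using u JJ DJ by auto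
    fix w assume "w \<in> ?W'"
    then have "w \<in> ?W" by (auto simp: perp_def)
    then show "g (J u) (J w) = g u w" "g (D u) w = - g u (D w)" using iso skew u(1) by auto
  qed
  \<comment> \<open>\<open>D\<close> maps \<open>J v\<close> to \<open>m v\<close> and
    \<open>v\<close> to \<open>- m J v\<close>; exchanging the two vectors changes the sign of the
    factor.\<close>
  show ?thesis
  proof (cases "m \<ge> 0")
    case True
    then show ?thesis
      using v(1,2) Jv vJv JW[OF v(1)] Dv DJv W'
      by (intro exI[of _ "J v"] exI[of _ v] exI[of _ m]) (simp add: insert_commute)
  next
    case False
    then show ?thesis
      using v(1,2) Jv vJv JW[OF v(1)] Dv DJv W'
      by (intro exI[of _ v] exI[of _ "J v"] exI[of _ "- m"]) simp
  qed
qed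

section \<open>The structure of almost abelian coKaehler algebras\<close>

context cokahler_structure
begin

section \<open>Identities for the structure tensors and the adjoint action\<close>

lemma bilinear_g: "bilinear g" and g_commute: "g x y = g y x" and g_pos: "x \<noteq> 0 \<Longrightarrow> g x x > 0"
  using inner_product_g by (auto simp: inner_product_def)

lemmas gs = bilinear_simps[OF bilinear_g]
lemmas bs = bilinear_simps[OF bilinear_br]

lemma g_self_eq_0: "g x x = 0 \<longleftrightarrow> x = 0"
  using g_pos[of x] by (cases "x = 0") (auto simp: gs)

text \<open>From \<open>J (J \<xi>) = 0\<close> it follows that \<open>J \<xi>\<close> is a multiple
  of \<open>\<xi>\<close>; applying \<open>J\<close> again, the factor or \<open>J \<xi>\<close>
  vanishes.\<close>

lemma J_xi: "J \<xi> = 0"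
proof -
  have JJ: "J (J \<xi>) = 0" using J_squared[of \<xi>] alpha_xi by simp
  then have "J \<xi> = \<alpha> (J \<xi>) *\<^sub>R \<xi>" using J_squared[of "J \<xi>"] linear_0[OF linear_J] by simp
  then have "0 = \<alpha> (J \<xi>) *\<^sub>R J \<xi>" using JJ linear_scale[OF linear_J] by metis
  then show ?thesis using \<open>J \<xi> = _\<close> by (metis scaleR_eq_0_iff scaleR_zero_left)
qed

lemma alpha_J: "\<alpha> (J x) = 0"
proof -
  have "J (J (J x)) = - J x"
    by (subst J_squared[of x]) (simp add: linear_diff[OF linear_J] linear_scale[OF linear_J] J_xi)
  then have "\<alpha> (J x) *\<^sub>R \<xi> = 0" using J_squared[of "J x"] by simp
  then show ?thesis using xi_nonzero by simp
qed

lemma g_xi: "g \<xi> x = \<alpha> x"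
  using J_compatible[of \<xi> x] J_xi alpha_xi by (simp add: gs)

lemma J_skew: "g (J x) y = - g x (J y)"
  using J_compatible[of "J x" y] by (simp add: alpha_J J_squared gs g_xi alpha_J)

lemma JJ: "\<alpha> x = 0 \<Longrightarrow> J (J x) = - x"
  by (simp add: J_squared)

lemma alpha_br: "\<alpha> (br x y) = 0"
  using d_alpha[of x y] by (simp add: ce_d1_def)

text \<open>The hypotheses leave two terms of \<open>N_J\<close>, both inside \<open>J\<close>.
  \<open>J\<close> can be cancelled there since brackets and the image of \<open>J\<close> lie in
  \<open>ker \<alpha>\<close>.\<close>

lemma ad_commutes_J:
  assumes "br (J x) y = 0" "br (J x) (J y) = 0"
  shows "br x (J y) = J (br x y)"
proof -
  have "J (br x (J y)) = J (J (br x y))"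
    using N_J[of x y] assms by (simp add: nijenhuis_def linear_0[OF linear_J])
  then have "J (J (br x (J y))) = J (J (J (br x y)))" by simp
  then show ?thesis by (simp add: JJ alpha_br alpha_J linear_neg[OF linear_J])
qed

text \<open>Evaluate the closedness of \<open>\<omega>\<close> at \<open>x\<close>,
  \<open>y\<close>, \<open>J z\<close>: the term with \<open>br y (J z)\<close> drops out, and
  compatibility with \<open>J\<close> turns the other two into the claim.\<close>

lemma ad_skew:
  assumes "br x (J y) = J (br x y)" "br x (J z) = J (br x z)" "br y z = 0" "br y (J z) = 0" "\<alpha> z = 0"
  shows "g (br x y) z = - g y (br x z)"
proof -
  have "- g (J (br x y)) (J z) + g (J (br x (J z))) y = 0"
    using d_omega[of x y "J z"] assms(4) by (simp add: ce_d2_def linear_0[OF linear_J] gs)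
  then have "g (br x y) z = g (J (J (br x z))) y"
    using assms(2,5) by (simp add: J_compatible)
  also have "\<dots> = - g (br x z) y" by (simp add: JJ alpha_br gs)
  finally show ?thesis by (simp add: g_commute)
qed

lemma skew_hermitian_on_ad:
  assumes "subspace W" "\<And>u. u \<in> W \<Longrightarrow> \<alpha> u = 0 \<and> J u \<in> W \<and> br x u \<in> W \<and> br x (J u) = J (br x u)"
    and "\<And>u v. u \<in> W \<Longrightarrow> v \<in> W \<Longrightarrow> br u v = 0"
  shows "skew_hermitian_on g J (br x) W"
  unfolding skew_hermitian_on_def
  using assms(1,2) by (auto simp: JJ J_compatible intro!: ad_skew assms(3))

lemma linear_br: "linear (br x)"
  using bilinear_br by (simp add: bilinear_def)

lemma subspace_perp: "subspace (perp g S)"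
  unfolding perp_def by (rule subspaceI) (auto simp: gs)

section \<open>The two positions of the abelian ideal relative to the kernel of
  \<open>\<alpha>\<close>\<close>

lemma classify_abelian_kernel:
  assumes d: "dim (UNIV :: 'a set) = 7"
    and abelian: "\<And>u v. \<alpha> u = 0 \<Longrightarrow> \<alpha> v = 0 \<Longrightarrow> br u v = 0"
  shows "\<exists>a b c. 0 \<le> a \<and> 0 \<le> b \<and> 0 \<le> c \<and> lie_iso br (rot a b c)"
proof -
  have d7: "dim (UNIV :: 'a set) = DIM(real^7)" using d by simp
  note split = split_plane[OF d7 inner_product_g linear_J linear_br[of \<xi>]]
  have ker: "u \<in> perp g {\<xi>} \<longleftrightarrow> \<alpha> u = 0" for u by (simp add: perp_def g_xi)
  \<comment> \<open>As \<open>g \<xi> u = \<alpha> u\<close>, this complement is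
    \<open>ker \<alpha>\<close>; \<open>ad \<xi>\<close> commutes with \<open>J\<close> because
    \<open>J \<xi> = 0\<close>.\<close>
  have W: "skew_hermitian_on g J (br \<xi>) (perp g {\<xi>})"
  proof (rule skew_hermitian_on_ad[OF subspace_perp])
    fix u assume "u \<in> perp g {\<xi>}"
    then show "\<alpha> u = 0 \<and> J u \<in> perp g {\<xi>} \<and> br \<xi> u \<in> perp g {\<xi>} \<and> br \<xi> (J u) = J (br \<xi> u)"
      by (simp add: ker alpha_J alpha_br ad_commutes_J J_xi bs)
  qed (simp add: ker abelian)
  obtain p1 q1 a where 1: "p1 \<in> perp g {\<xi>}" "q1 \<in> perp g {\<xi>}" "p1 \<noteq> 0" "q1 \<noteq> 0" "g p1 q1 = 0"
    "a \<ge> 0" "br \<xi> p1 = a *\<^sub>R q1" "br \<xi> q1 = - a *\<^sub>R p1"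
    and W1: "skew_hermitian_on g J (br \<xi>) (perp g {p1, q1, \<xi>})"
    using split[OF W] by auto
  \<comment> \<open>At most three vectors so far, then at most five, so a further plane can be split
    off each time.\<close>
  have "card {p1, q1, \<xi>} < 7" by (auto simp: card_insert_if)
  then obtain p2 q2 b where 2: "p2 \<in> perp g {p1, q1, \<xi>}" "q2 \<in> perp g {p1, q1, \<xi>}" "p2 \<noteq> 0" "q2 \<noteq> 0"
    "g p2 q2 = 0" "b \<ge> 0" "br \<xi> p2 = b *\<^sub>R q2" "br \<xi> q2 = - b *\<^sub>R p2"
    and W2: "skew_hermitian_on g J (br \<xi>) (perp g {p2, q2, p1, q1, \<xi>})"
    using split[OF W1] by auto
  have "card {p2, q2, p1, q1, \<xi>} < 7" by (auto simp: card_insert_if)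
  then obtain p3 q3 c where 3: "p3 \<in> perp g {p2, q2, p1, q1, \<xi>}" "q3 \<in> perp g {p2, q2, p1, q1, \<xi>}"
    "p3 \<noteq> 0" "q3 \<noteq> 0" "g p3 q3 = 0" "c \<ge> 0" "br \<xi> p3 = c *\<^sub>R q3" "br \<xi> q3 = - c *\<^sub>R p3"
    using split[OF W2] by auto
  define B where "B = case_sum (pair p1 q1) (case_sum (pair p2 q2) (pair p3 q3))"
  have ortho: "orthogonal_family g B"
    unfolding B_def using 1 2 3
    by (intro orthogonal_family_case_sum orthogonal_family_pair inner_product_g)
      (auto simp: perp_def pair_def split: sum.split)
  have B: "\<alpha> (B i) = 0" for i
    using 1 2 3 by (auto simp: B_def perp_def pair_def g_xi split: sum.split)
  have "lie_iso br (rot a b c)"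
    unfolding rot_def
  proof (rule lie_iso_orthogonal_basis[OF lie_algebra_axioms inner_product_g, where x = \<xi> and b = B])
    show "acts (br \<xi>) (Rmat a \<oplus>\<^sub>m Rmat b \<oplus>\<^sub>m Rmat c) B"
      unfolding B_def using 1 2 3 by (intro acts_block_sum acts_pair) auto
  qed (auto simp: d xi_nonzero ortho B abelian g_xi)
  then show ?thesis using 1 2 3 by blast
qed

text \<open>\<open>J e\<close> is orthogonal to \<open>e\<close>, hence in \<open>I\<close>, and so
  commutes with the Hermitian complement of \<open>\<xi>, e, J e\<close>, which also lies in
  \<open>I\<close>. This is what \<open>ad_commutes_J\<close> requires for
  \<open>ad e\<close>.\<close>

lemma abelian_ideal_frame:
  assumes I: "lie_ideal br I" "\<And>u v. u \<in> I \<Longrightarrow> v \<in> I \<Longrightarrow> br u v = 0"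
    and e: "e \<noteq> 0" "\<alpha> e = 0" "\<And>u. \<alpha> u = 0 \<Longrightarrow> u \<in> I \<longleftrightarrow> g e u = 0"
  shows "J e \<in> I" and "perp g {\<xi>, e, J e} \<subseteq> I"
    and "skew_hermitian_on g J (br e) (perp g {\<xi>, e, J e})"
    and "\<exists>c. br e (J e) = c *\<^sub>R J e"
proof -
  let ?W = "perp g {\<xi>, e, J e}"
  have W: "u \<in> ?W \<longleftrightarrow> \<alpha> u = 0 \<and> g e u = 0 \<and> g (J e) u = 0" for u
    by (simp add: perp_def g_xi)
  have eJe: "g e (J e) = 0" using J_skew[of e e] g_commute[of e "J e"] by simp
  show JeI: "J e \<in> I" using e(3)[of "J e"] alpha_J eJe by simp
  show WI: "?W \<subseteq> I" using e(3) W by blast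
  \<comment> \<open>Such a bracket lies in \<open>I\<close> and in \<open>ker \<alpha>\<close>,
    where membership in \<open>I\<close> means orthogonality to \<open>e\<close>.\<close>
  have ge_br: "g e (br x u) = 0" if "u \<in> I" for x u
    using I(1) e(3)[OF alpha_br] that by (auto simp: lie_ideal_def)
  have JW: "J u \<in> ?W" if "u \<in> ?W" for u
    using that J_skew[of e u] J_compatible[of e u] by (simp add: W alpha_J)
  have comm: "br e (J u) = J (br e u)" if "u \<in> ?W" for u
    using that JW[OF that] WI JeI I(2) by (intro ad_commutes_J) auto
  \<comment> \<open>For the component along \<open>J e\<close>, move \<open>J\<close> across
    \<open>g\<close> and through \<open>ad e\<close>, which leaves \<open>br e (J u)\<close>,
    orthogonal to \<open>e\<close>.\<close>
  have brW: "br e u \<in> ?W" if "u \<in> ?W" for u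
    using that WI JW[OF that] comm[OF that] ge_br[of u e] ge_br[of "J u" e] J_skew[of e "br e u"]
    by (auto simp: W alpha_br)
  show "skew_hermitian_on g J (br e) ?W"
  proof (rule skew_hermitian_on_ad[OF subspace_perp])
    show "\<alpha> u = 0 \<and> J u \<in> ?W \<and> br e u \<in> ?W \<and> br e (J u) = J (br e u)" if "u \<in> ?W" for u
      using that JW brW comm W by blast
    show "br u v = 0" if "u \<in> ?W" "v \<in> ?W" for u v
      using that WI I(2) by blast
  qed
  show "\<exists>c. br e (J e) = c *\<^sub>R J e"
  proof -
    define w where "w = br e (J e)"
    define c where "c = g (J e) w / g (J e) (J e)"
    \<comment> \<open>The part of \<open>w\<close> orthogonal to \<open>J e\<close>. It lies in
      \<open>?W\<close>, while \<open>w\<close> is orthogonal to \<open>?W\<close>, so it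
      vanishes.\<close>
    define w' where "w' = w - c *\<^sub>R J e"
    have gJe: "g (J e) (J e) > 0" using J_compatible[of e e] e g_pos by simp
    have orth: "g w u = 0" if "u \<in> ?W" for u
    proof -
      have "br (J e) (J u) = 0" using JW[OF that] WI JeI I(2) by auto
      moreover have "g (J (br e (J u))) (J e) = 0"
        using ge_br[of "J u" e] JW[OF that] WI by (auto simp: J_compatible e g_commute)
      ultimately have "g (J w) (J u) = 0"
        using d_omega[of e "J e" "J u"] by (simp add: ce_d2_def w_def linear_0[OF linear_J] gs)
      then show ?thesis using that by (simp add: J_compatible w_def alpha_br)
    qed
    have "w' \<in> ?W"
      using gJe ge_br[OF JeI, of e] eJe
      by (simp add: W w'_def c_def w_def linear_diff[OF linear_alpha] linear_scale[OF linear_alpha]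
          alpha_br alpha_J gs)
    then have "g w' w' = 0" using orth[of w'] by (simp add: w'_def gs W algebra_simps)
    then have "w' = 0" by (simp add: g_self_eq_0)
    then show ?thesis by (auto simp: w'_def w_def)
  qed
qed

lemma classify_transversal_ideal:
  assumes d: "dim (UNIV :: 'a set) = 7"
    and I: "lie_ideal br I" "\<And>u v. u \<in> I \<Longrightarrow> v \<in> I \<Longrightarrow> br u v = 0"
    and e: "e \<noteq> 0" "\<alpha> e = 0" "\<And>u. \<alpha> u = 0 \<Longrightarrow> u \<in> I \<longleftrightarrow> g e u = 0"
    and c: "br e (J e) = c *\<^sub>R J e" "c = 0 \<or> c = 1"
    and z0: "z0 \<in> I" "\<alpha> z0 = 1"
  shows "(\<exists>a b. 0 \<le> a \<and> 0 \<le> b \<and> lie_iso br (rot a b 0)) \<or>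
    (\<exists>a b. 0 \<le> a \<and> 0 \<le> b \<and> lie_iso br (R_times (h3 a b)))"
proof -
  note frame = abelian_ideal_frame(1-3)[OF I e]
  have sI: "subspace I" and ideal: "\<And>x u. u \<in> I \<Longrightarrow> br x u \<in> I"
    using I(1) by (auto simp: lie_ideal_def)
  have gee: "g e e > 0" using e(1) by (rule g_pos)
  \<comment> \<open>Chosen to make \<open>z0 - z\<close> orthogonal to \<open>e\<close>; it also
    lies in \<open>ker \<alpha>\<close>, hence in \<open>I\<close>.\<close>
  define t where "t = g e (z0 - \<xi>) / g e e"
  define z where "z = \<xi> + t *\<^sub>R e"
  have gz: "g z u = \<alpha> u + t * g e u" for u by (simp add: z_def gs g_xi)
  have \<alpha>z: "\<alpha> z = 1"
    by (simp add: z_def linear_add[OF linear_alpha] linear_scale[OF linear_alpha] alpha_xi e)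
  have zI: "z \<in> I"
  proof -
    have "z0 - z \<in> I"
      using gee z0(2) \<alpha>z by (subst e(3)) (simp_all add: linear_diff[OF linear_alpha] z_def t_def gs)
    then have "z0 - (z0 - z) \<in> I" by (rule subspace_diff[OF sI z0(1)])
    then show ?thesis by simp
  qed
  have zJe: "br z (J e) = 0" using zI frame(1) I(2) by simp
  \<comment> \<open>Since \<open>z\<close> and \<open>J e\<close> commute,
    \<open>br \<xi> (J e)\<close> is known; commuting with \<open>J\<close> transfers this to
    \<open>br \<xi> e\<close>.\<close>
  have "br \<xi> (J e) = J (br \<xi> e)" by (rule ad_commutes_J) (simp_all add: J_xi bs)
  then have "J (br \<xi> e) = - (t * c) *\<^sub>R J e"
    using zJe by (simp add: z_def bs c eq_neg_iff_add_eq_0)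
  then have "J (J (br \<xi> e)) = - (t * c) *\<^sub>R J (J e)" by (simp add: linear_scale[OF linear_J] linear_neg[OF linear_J])
  then have "- br \<xi> e = (t * c) *\<^sub>R e"
    using JJ[OF alpha_br, of \<xi> e] JJ[OF e(2)] by simp
  then have xie: "br \<xi> e = - (t * c) *\<^sub>R e"
    by (metis add.inverse_inverse scaleR_minus_left)
  \<comment> \<open>The bracket is a multiple of \<open>e\<close>, but it also lies in
    \<open>I\<close> and \<open>ker \<alpha>\<close>, hence is orthogonal to \<open>e\<close>. So
    \<open>z\<close> commutes with \<open>e\<close> as well as with \<open>I\<close>.\<close>
  have ze: "br z e = 0"
  proof -
    have eq: "br z e = br \<xi> e" by (simp add: z_def bs alternating)
    have "br e z \<in> I" using zI by (rule ideal)
    then have "g e (br z e) = 0" using e(3)[OF alpha_br] antisymmetric[of z e] by (simp add: gs)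
    then have "t * c = 0" using gee by (simp add: eq xie gs)
    then show ?thesis by (simp add: eq xie)
  qed
  \<comment> \<open>Gram-Schmidt makes the acting vector orthogonal to \<open>z\<close>; subtracting
    a multiple of \<open>z\<close> does not alter its action on \<open>I\<close>.\<close>
  define r where "r = g e z / g z z"
  define x where "x = e - r *\<^sub>R z"
  have z: "z \<noteq> 0" using \<alpha>z linear_0[OF linear_alpha] by auto
  have gxz: "g x z = 0" using g_pos[OF z] by (simp add: x_def r_def gs)
  have gx: "g x u = 0" and gzu: "g z u = 0" "g u z = 0" if "\<alpha> u = 0" "g e u = 0" for u
    using that by (simp_all add: x_def gs gz g_commute[of u z])
  have x: "x \<noteq> 0"
  proof
    assume x: "x = 0"
    then have "\<alpha> x = 0" using linear_0[OF linear_alpha] by simp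
    then have "r = 0" by (simp add: x_def linear_diff[OF linear_alpha] linear_scale[OF linear_alpha] e \<alpha>z)
    then show False using x e by (simp add: x_def)
  qed
  have brx: "br x u = br e u" if "u \<in> I" for u
    using that I(2)[OF zI] by (simp add: x_def bs)
  have brxz: "br x z = 0"
    using ze antisymmetric[of e z] by (simp add: x_def bs alternating)
  have Je: "J e \<noteq> 0" "\<alpha> (J e) = 0" "g e (J e) = 0"
    using J_compatible[of e e] e gee alpha_J frame(1) by (auto simp: gs)
  have d7: "dim (UNIV :: 'a set) = DIM(real^7)" using d by simp
  note split = split_plane[OF d7 inner_product_g linear_J linear_br[of e]]
  have "card {\<xi>, e, J e} < 7" by (auto simp: card_insert_if)
  then obtain p1 q1 a where 1: "p1 \<in> perp g {\<xi>, e, J e}" "q1 \<in> perp g {\<xi>, e, J e}" "p1 \<noteq> 0" "q1 \<noteq> 0"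
    "g p1 q1 = 0" "a \<ge> 0" "br e p1 = a *\<^sub>R q1" "br e q1 = - a *\<^sub>R p1"
    and W1: "skew_hermitian_on g J (br e) (perp g {p1, q1, \<xi>, e, J e})"
    using split[OF frame(3)] by auto
  have "card {p1, q1, \<xi>, e, J e} < 7" by (auto simp: card_insert_if)
  then obtain p2 q2 b where 2: "p2 \<in> perp g {p1, q1, \<xi>, e, J e}" "q2 \<in> perp g {p1, q1, \<xi>, e, J e}"
    "p2 \<noteq> 0" "q2 \<noteq> 0" "g p2 q2 = 0" "b \<ge> 0" "br e p2 = b *\<^sub>R q2" "br e q2 = - b *\<^sub>R p2"
    using split[OF W1] by auto
  have in_W: "u \<in> perp g {\<xi>, e, J e}" if "u \<in> {p1, q1, p2, q2}" for u
    using that 1(1,2) 2(1,2) by (auto simp: perp_def)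
  have in_I: "u \<in> I" if "u \<in> {p1, q1, p2, q2, J e, z}" for u
    using that in_W frame(1,2) zI by blast
  have perp_e: "\<alpha> u = 0 \<and> g e u = 0" if "u \<in> {p1, q1, p2, q2, J e}" for u
    using that in_W Je by (auto simp: perp_def g_xi)
  have perp_Je: "g (J e) u = 0 \<and> g u (J e) = 0" if "u \<in> {p1, q1, p2, q2}" for u
    using that in_W g_commute[of u "J e"] by (auto simp: perp_def)
  have perp_z: "g z u = 0 \<and> g u z = 0" if "u \<in> {p1, q1, p2, q2, J e}" for u
    using gzu perp_e[OF that] by blast
  have perp_x: "g x u = 0" if "u \<in> {p1, q1, p2, q2, J e, z}" for u
    using that gx perp_e gxz by blast
  have act: "br x p1 = a *\<^sub>R q1" "br x q1 = - a *\<^sub>R p1" "br x p2 = b *\<^sub>R q2" "br x q2 = - b *\<^sub>R p2"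
    "br x (J e) = c *\<^sub>R J e"
    using brx in_I 1(7,8) 2(7,8) c(1) by auto
  note ortho_intros = orthogonal_family_case_sum orthogonal_family_pair inner_product_g
  note basis = lie_iso_orthogonal_basis[OF lie_algebra_axioms inner_product_g, where x = x]
  from c(2) show ?thesis
  proof
    assume c0: "c = 0"
    \<comment> \<open>Both \<open>J e\<close> and \<open>z\<close> are annihilated by
      \<open>ad x\<close> and together form the block \<open>R(0)\<close>.\<close>
    define B where "B = case_sum (pair p1 q1) (case_sum (pair p2 q2) (pair (J e) z))"
    have ran: "B i \<in> {p1, q1, p2, q2, J e, z}" for i
      by (auto simp: B_def pair_def split: sum.split)
    have ortho: "orthogonal_family g B"
      unfolding B_def using 1 2 z Je(1) perp_z perp_Je
      by (intro ortho_intros) (auto simp: perp_def pair_def split: sum.split)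
    have "lie_iso br (rot a b 0)"
      unfolding rot_def
    proof (rule basis)
      show "acts (br x) (Rmat a \<oplus>\<^sub>m Rmat b \<oplus>\<^sub>m Rmat 0) B"
        unfolding B_def using act brxz c0 by (intro acts_block_sum acts_pair) auto
    qed (use d x ortho ran perp_x in_I I(2) in auto)
    then show ?thesis using 1(6) 2(6) by blast
  next
    assume c1: "c = 1"
    \<comment> \<open>Here \<open>z\<close> spans the zero block and \<open>J e\<close> the block
      with eigenvalue one.\<close>
    define B where "B = case_sum (\<lambda>_::1. z) (case_sum (\<lambda>_::1. J e) (case_sum (pair p1 q1) (pair p2 q2)))"
    have ran: "B i \<in> {p1, q1, p2, q2, J e, z}" for i
      by (auto simp: B_def pair_def split: sum.split)
    have const: "orthogonal_family g (\<lambda>_::1. u)" if "u \<noteq> 0" for u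
      using that by (simp add: orthogonal_family_def num1_eq1)
    have ortho: "orthogonal_family g B"
      unfolding B_def using 1 2 z Je(1) perp_z perp_Je
      by (intro ortho_intros const) (auto simp: perp_def pair_def split: sum.split)
    have "lie_iso br (semidirect ((mat 0 :: real^1^1) \<oplus>\<^sub>m (mat 1 :: real^1^1) \<oplus>\<^sub>m Rmat a \<oplus>\<^sub>m Rmat b))"
    proof (rule basis)
      show "acts (br x) ((mat 0 :: real^1^1) \<oplus>\<^sub>m (mat 1 :: real^1^1) \<oplus>\<^sub>m Rmat a \<oplus>\<^sub>m Rmat b) B"
        unfolding B_def using act brxz c1 by (intro acts_block_sum acts_pair acts_mat) auto
    qed (use d x ortho ran perp_x in_I I(2) in auto)
    then have "lie_iso br (R_times (h3 a b))" using R_times_h3 lie_iso_trans by blast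
    then show ?thesis using 1(6) 2(6) by blast
  qed
qed

lemma classify:
  assumes d: "dim (UNIV :: 'a set) = 7" and aa: "almost_abelian br"
  shows "(\<exists>a b c. 0 \<le> a \<and> 0 \<le> b \<and> 0 \<le> c \<and> lie_iso br (rot a b c)) \<or>
    (\<exists>a b. 0 \<le> a \<and> 0 \<le> b \<and> lie_iso br (R_times (h3 a b)))"
proof -
  have d7: "dim (UNIV :: 'a set) = DIM(real^7)" using d by simp
  obtain I where I: "lie_ideal br I" "\<And>u v. u \<in> I \<Longrightarrow> v \<in> I \<Longrightarrow> br u v = 0" "dim I + 1 = 7"
    using aa d by (auto simp: almost_abelian_def)
  have sI: "subspace I" using I(1) by (simp add: lie_ideal_def)
  obtain \<beta> u0 where \<beta>: "linear \<beta>" "\<beta> u0 \<noteq> (0::real)" "I = {u. \<beta> u = 0}"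
    using codim1_subspace_is_kernel[OF d7 sI] I(3) by auto
  show ?thesis
  proof (cases "\<forall>u\<in>I. \<alpha> u = 0")
    case True
    have "\<beta> u = 0" if "\<alpha> u = 0" for u
    proof (rule ccontr)
      assume u: "\<beta> u \<noteq> 0"
      \<comment> \<open>Correcting \<open>\<xi>\<close> by a multiple of \<open>u\<close> brings it
        into \<open>I\<close> while \<open>\<alpha>\<close> keeps the value one, against
        \<open>True\<close>.\<close>
      have "\<xi> - (\<beta> \<xi> / \<beta> u) *\<^sub>R u \<in> I"
        using u by (simp add: \<beta>(3) linear_diff[OF \<beta>(1)] linear_scale[OF \<beta>(1)])
      then show False
        using True that
        by (auto simp: linear_diff[OF linear_alpha] linear_scale[OF linear_alpha] alpha_xi)
    qed
    then have "br u v = 0" if "\<alpha> u = 0" "\<alpha> v = 0" for u v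
      using that I(2) \<beta>(3) by blast
    from classify_abelian_kernel[OF d this] show ?thesis by blast
  next
    case False
    then obtain y where y: "y \<in> I" "\<alpha> y \<noteq> 0" by blast
    define z0 where "z0 = (1 / \<alpha> y) *\<^sub>R y"
    have z0: "z0 \<in> I" "\<alpha> z0 = 1"
      using y sI by (simp_all add: z0_def subspace_scale linear_scale[OF linear_alpha])
    obtain w where w: "\<And>u. \<beta> u = g w u" using riesz_vector[OF d7 inner_product_g \<beta>(1)] by blast
    \<comment> \<open>The projection to \<open>ker \<alpha>\<close> of the normal vector
      \<open>w\<close> of \<open>I\<close>. It is non-zero since otherwise \<open>\<beta>\<close>
      would be a multiple of \<open>\<alpha>\<close>, and a zero multiple by evaluation at
      \<open>y\<close>.\<close>
    define e where "e = w - \<alpha> w *\<^sub>R \<xi>"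
    have \<beta>e: "\<beta> u = g e u + \<alpha> w * \<alpha> u" for u by (simp add: w e_def gs g_xi)
    have e2: "\<alpha> e = 0"
      by (simp add: e_def linear_diff[OF linear_alpha] linear_scale[OF linear_alpha] alpha_xi)
    have e1: "e \<noteq> 0"
    proof
      assume "e = 0"
      then have "\<beta> u = \<alpha> w * \<alpha> u" for u using \<beta>e by (simp add: gs)
      then show False using \<beta>(2,3) y by auto
    qed
    have e3: "u \<in> I \<longleftrightarrow> g e u = 0" if "\<alpha> u = 0" for u using that by (simp add: \<beta>(3) \<beta>e)
    obtain c where c: "br e (J e) = c *\<^sub>R J e" using abelian_ideal_frame(4)[OF I(1,2) e1 e2 e3] by blast
    \<comment> \<open>Rescaling \<open>e\<close> by \<open>s\<close> multiplies its eigenvalue on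
      \<open>J e\<close> by \<open>s\<close>, so it becomes zero or one.\<close>
    define s where "s = (if c = 0 then 1 else 1 / c)"
    have s: "s \<noteq> 0" by (simp add: s_def)
    note transversal = classify_transversal_ideal[OF d I(1,2) _ _ _ _ _ z0, of "s *\<^sub>R e" "s * c"]
    have "(\<exists>a b. 0 \<le> a \<and> 0 \<le> b \<and> lie_iso br (rot a b 0)) \<or>
      (\<exists>a b. 0 \<le> a \<and> 0 \<le> b \<and> lie_iso br (R_times (h3 a b)))"
    proof (rule transversal)
      show "br (s *\<^sub>R e) (J (s *\<^sub>R e)) = (s * c) *\<^sub>R J (s *\<^sub>R e)"
        by (simp add: linear_scale[OF linear_J] bs c)
      show "s * c = 0 \<or> s * c = 1" by (simp add: s_def)
      show "s *\<^sub>R e \<noteq> 0" "\<alpha> (s *\<^sub>R e) = 0" using s e1 e2 by (simp_all add: linear_scale[OF linear_alpha])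
      show "u \<in> I \<longleftrightarrow> g (s *\<^sub>R e) u = 0" if "\<alpha> u = 0" for u using e3[OF that] s by (simp add: gs)
    qed
    then show ?thesis by (meson order_refl)
  qed
qed

end

section \<open>Normalisation of the parameters and the classification\<close>

lemma ex_entry_rot:
  fixes br :: "'a::real_vector \<Rightarrow> 'a \<Rightarrow> 'a"
  assumes "0 \<le> a" "0 \<le> b" "0 \<le> c" "lie_iso br (rot a b c)"
  shows "\<exists>e. admissible e \<and> iso_to br e"
proof -
  obtain a' b' c' where s: "a' \<ge> b'" "b' \<ge> c'" "c' \<ge> 0" "lie_iso (rot a b c) (rot a' b' c')"
    using rot_sort[OF assms(1-3)] by blast
  have iso: "lie_iso br (rot a' b' c')" using assms(4) s(4) by (rule lie_iso_trans)
  show ?thesis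
  proof (cases "a' = 0")
    case True
    then have zero: "a' = 0" "b' = 0" "c' = 0" using s by auto
    obtain \<phi> :: "real \<times> R6 \<Rightarrow> real^7" where "linear \<phi>" "bij \<phi>"
      using ex_linear_bij_euclidean[where 'e = "real \<times> R6" and 'a = "real^7"] by auto
    then have "lie_iso (abelian_bracket :: real \<times> R6 \<Rightarrow> _) (abelian_bracket :: real^7 \<Rightarrow> _)"
      unfolding lie_iso_def abelian_bracket_def using linear_0 by blast
    moreover have "lie_iso br (abelian_bracket :: real \<times> R6 \<Rightarrow> _)" using iso zero by (simp add: rot_0)
    ultimately have "iso_to br Abelian" using lie_iso_trans by simp
    then show ?thesis using admissible.simps(1) by blast
  next
    case False
    then have a': "a' > 0" using s by simp
    \<comment> \<open>Dividing by the largest parameter makes it one; the number of zeros among the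
      others selects the entry.\<close>
    have "lie_iso br (rot 1 (b' / a') (c' / a'))"
      using lie_iso_trans[OF iso rot_scale[of "1 / a'"]] a' by simp
    moreover have "b' / a' \<le> 1" "c' / a' \<le> b' / a'" using a' s by (simp_all add: divide_right_mono)
    ultimately consider "iso_to br Rot1" | "b' / a' > 0" "iso_to br (Rot2 (b' / a'))"
      | "c' / a' > 0" "iso_to br (Rot3 (b' / a') (c' / a'))"
      using s a' by (cases "c' = 0"; cases "b' = 0") auto
    then show ?thesis
    proof cases
      case 1
      then show ?thesis using admissible.simps(2) by blast
    next
      case 2
      then show ?thesis using \<open>b' / a' \<le> 1\<close> by (intro exI[of _ "Rot2 (b' / a')"]) simp
    next
      case 3
      then show ?thesis using \<open>b' / a' \<le> 1\<close> \<open>c' / a' \<le> b' / a'\<close>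
        by (intro exI[of _ "Rot3 (b' / a') (c' / a')"]) simp
    qed
  qed
qed

text \<open>The block with eigenvalue one already fixes the scale, so it only remains to sort the
  two parameters.\<close>

lemma ex_entry_R_times_h3:
  assumes "0 \<le> a" "0 \<le> b" "lie_iso br (R_times (h3 a b))"
  shows "\<exists>e. admissible e \<and> iso_to br e"
proof -
  have sorted: "\<exists>e. admissible e \<and> iso_to br e"
    if h: "0 \<le> b" "b \<le> a" "lie_iso br (R_times (h3 a b))" for a b
  proof -
    consider "a = 0" "b = 0" | "a > 0" "b = 0" | "b > 0" using h(1,2) by fastforce
    then show ?thesis
    proof cases
      case 1
      then show ?thesis using that by (intro exI[of _ Prod1]) (simp add: h3_0)
    next
      case 2
      then show ?thesis using that by (intro exI[of _ "Prod2 a"]) (simp add: h3_0)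
    next
      case 3
      then show ?thesis using that by (intro exI[of _ "Prod3 a b"]) simp
    qed
  qed
  have "lie_iso (R_times (h3 a b)) (R_times (h3 b a))"
    unfolding h3_def by (intro lie_iso_R_times lie_iso_swap_inner)
  then have "lie_iso br (R_times (h3 b a))" using assms(3) lie_iso_trans by blast
  then show ?thesis using sorted[of b a] sorted[of a b] assms by (cases "a \<le> b") auto
qed

theorem proposition5p2:
  fixes br :: "'a::real_vector \<Rightarrow> 'a \<Rightarrow> 'a"
  shows
    "(lie_algebra br \<and> dim (UNIV :: 'a set) = 7 \<and> almost_abelian br
        \<and> (\<exists>J \<xi> \<alpha> g. cokahler_structure br J \<xi> \<alpha> g)
      \<longrightarrow> (\<exists>!e. admissible e \<and> iso_to br e))
     \<and> (\<forall>l l'. admissible (Rot2 l) \<and> admissible (Rot2 l') \<and> l \<noteq> l'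
          \<longrightarrow> \<not> lie_iso (rot 1 l 0) (rot 1 l' 0))
     \<and> (\<forall>l a l' a'. admissible (Rot3 l a) \<and> admissible (Rot3 l' a') \<and> (l, a) \<noteq> (l', a')
          \<longrightarrow> \<not> lie_iso (rot 1 l a) (rot 1 l' a'))
     \<and> (\<forall>l l'. admissible (Prod2 l) \<and> admissible (Prod2 l') \<and> l \<noteq> l'
          \<longrightarrow> \<not> lie_iso (R_times (h2 l)) (R_times (h2 l')))
     \<and> (\<forall>l1 l2 l1' l2'. admissible (Prod3 l1 l2) \<and> admissible (Prod3 l1' l2') \<and> (l1, l2) \<noteq> (l1', l2')
          \<longrightarrow> \<not> lie_iso (R_times (h3 l1 l2)) (R_times (h3 l1' l2')))"
proof (intro conjI impI allI notI)
  assume h: "lie_algebra br \<and> dim (UNIV :: 'a set) = 7 \<and> almost_abelian br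
        \<and> (\<exists>J \<xi> \<alpha> g. cokahler_structure br J \<xi> \<alpha> g)"
  then obtain J \<xi> \<alpha> g where "cokahler_structure br J \<xi> \<alpha> g" by blast
  then interpret cokahler_structure br J \<xi> \<alpha> g .
  have "\<exists>e. admissible e \<and> iso_to br e"
    using classify h ex_entry_rot ex_entry_R_times_h3 by blast
  then show "\<exists>!e. admissible e \<and> iso_to br e" using entry_unique by blast
next
  fix l l' assume h: "admissible (Rot2 l) \<and> admissible (Rot2 l') \<and> l \<noteq> l'"
    and iso: "lie_iso (rot 1 l 0) (rot 1 l' 0)"
  \<comment> \<open>The algebra is an instance of the first entry by reflexivity and of the second
    by \<open>iso\<close>, so uniqueness identifies their parameters. The remaining cases run
    alike.\<close>
  show False
    using entry_unique[of "Rot2 l" "Rot2 l'" "rot 1 l 0"] h iso lie_iso_refl[of "rot 1 l 0"] by simp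
next
  fix l a l' a' assume h: "admissible (Rot3 l a) \<and> admissible (Rot3 l' a') \<and> (l, a) \<noteq> (l', a')"
    and iso: "lie_iso (rot 1 l a) (rot 1 l' a')"
  show False
    using entry_unique[of "Rot3 l a" "Rot3 l' a'" "rot 1 l a"] h iso lie_iso_refl[of "rot 1 l a"] by simp
next
  fix l l' assume h: "admissible (Prod2 l) \<and> admissible (Prod2 l') \<and> l \<noteq> l'"
    and iso: "lie_iso (R_times (h2 l)) (R_times (h2 l'))"
  show False
    using entry_unique[of "Prod2 l" "Prod2 l'" "R_times (h2 l)"] h iso lie_iso_refl[of "R_times (h2 l)"] by simp
next
  fix l1 l2 l1' l2' assume h: "admissible (Prod3 l1 l2) \<and> admissible (Prod3 l1' l2') \<and> (l1, l2) \<noteq> (l1', l2')"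
    and iso: "lie_iso (R_times (h3 l1 l2)) (R_times (h3 l1' l2'))"
  show False
    using entry_unique[of "Prod3 l1 l2" "Prod3 l1' l2'" "R_times (h3 l1 l2)"] h iso lie_iso_refl[of "R_times (h3 l1 l2)"] by simp
qed

end
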